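(* Let $\sigma$ be a connection on $B(\mathcal{H})^+$ with representing function $f:[0,\infty)\to[0,\infty)$ and associated measure $\mu$ on $[0,1]$. Then the following statements are equivalent: (1) $\sigma$ is left cancellable, i.e. for all $A>0$, $B\ge 0$, $C\ge 0$ in $B(\mathcal{H})$, $A\,\sigma\,B=A\,\sigma\,C$ implies $B=C$; (2) for all $A\ge 0$ and $B\ge 0$, $I\,\sigma\,A=I\,\sigma\,B$ implies $A=B$; (3) $\sigma$ is not a scalar multiple of the left-trivial mean, i.e. there is no $k\ge 0$ with $A\,\sigma\,B=kA$ for all $A,B\ge 0$; (4) $f$ is injective, i.e. $f$ is left cancellable in the sense that for functions $g,h$ with values in $[0,\infty)$ and a common domain, $f\circ g=f\circ h$ implies $g=h$; (5) $f$ is a nonconstant function; (6) $\mu$ is not a scalar multiple of the Dirac measure $\delta_0$ at $0$.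
   Context: $\mathcal{H}$ is a Hilbert space, $B(\mathcal{H})$ the bounded linear operators on it, $B(\mathcal{H})^+$ the positive (semidefinite) operators; $A\le B$ means $B-A\in B(\mathcal{H})^+$; $A>0$ means $A$ is strictly positive (positive and invertible). A connection is a binary operation $\sigma$ on $B(\mathcal{H})^+$ such that for all positive $A,B,C,D$: (M1) $A\le C$, $B\le D$ imply $A\,\sigma\,B\le C\,\sigma\,D$; (M2) $C(A\,\sigma\,B)C\le (CAC)\,\sigma\,(CBC)$; (M3) if $A_n\downarrow A$ and $B_n\downarrow B$ then $A_n\,\sigma\,B_n\downarrow A\,\sigma\,B$, where $A_n\downarrow A$ means $(A_n)$ is a decreasing sequence converging strongly to $A$. A function $f:[0,\infty)\to[0,\infty)$ is operator monotone if (with the continuous functional calculus, $f$ continuous) $A\le B$ implies $f(A)\le f(B)$ for all positive operators $A,B$ on every Hilbert space. Representing function (Kubo–Ando theorem, taken as known): for a connection $\sigma$ there is a unique operator monotone $f:[0,\infty)\to[0,\infty)$ with $f(x)I=I\,\sigma\,(xI)$ for all $x\ge 0$; $\sigma\mapsto f$ is a bijection, and $f(A)=I\,\sigma\,A$ for all $A\ge0$. Associated measure (taken as known): for a connection $\sigma$ there is a unique finite positive Borel measure $\mu$ on $[0,1]$ with $A\,\sigma\,B=\int_{[0,1]}A\,!_t\,B\,d\mu(t)$ for all $A,B\ge 0$; then $f(x)=\int_{[0,1]}(1\,!_t\,x)\,d\mu(t)$ for $x\ge0$. Here $A\,!_t\,B=[(1-t)A^{-1}+tB^{-1}]^{-1}$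 for $A,B>0$, extended to $A,B\ge 0$ as the strong limit of $(A+\epsilon I)\,!_t\,(B+\epsilon I)$ as $\epsilon\downarrow 0$ (so $A\,!_0\,B=A$, $A\,!_1\,B=B$). The left-trivial mean is $(A,B)\mapsto A$. *)

theory Defs
  imports "HOL-Probability.Probability" "HOL-Library.Complex_Order"
    "HOL-Computational_Algebra.Polynomial"
begin

text \<open>Complex Hilbert spaces: the sesquilinear form is conjugate-linear in its first argument,
  and the underlying real Hilbert space carries its real part, so the norm is the usual one.\<close>

class complex_hilbert_space = real_inner + complete_space +
  fixes scaleC :: "complex \<Rightarrow> 'a \<Rightarrow> 'a" (infixr "*\<^sub>C" 75)
    and cinner :: "'a \<Rightarrow> 'a \<Rightarrow> complex"
  assumes scaleC_add_right: "a *\<^sub>C (x + y) = a *\<^sub>C x + a *\<^sub>C y"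
    and scaleC_add_left: "(a + b) *\<^sub>C x = a *\<^sub>C x + b *\<^sub>C x"
    and scaleC_scaleC: "a *\<^sub>C b *\<^sub>C x = (a * b) *\<^sub>C x"
    and scaleC_of_real: "complex_of_real r *\<^sub>C x = r *\<^sub>R x"
    and cinner_commute: "cinner x y = cnj (cinner y x)"
    and cinner_add_right: "cinner x (y + z) = cinner x y + cinner x z"
    and cinner_scaleC_right: "cinner x (a *\<^sub>C y) = a * cinner x y"
    and Re_cinner: "Re (cinner x y) = inner x y"

instantiation complex :: complex_hilbert_space
begin
definition scaleC_complex :: "complex \<Rightarrow> complex \<Rightarrow> complex" where "scaleC_complex a x = a * x"
definition cinner_complex :: "complex \<Rightarrow> complex \<Rightarrow> complex" where "cinner_complex x y = cnj x * y"
instance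
  by standard
    (auto simp: scaleC_complex_def cinner_complex_def algebra_simps inner_complex_def
      scaleR_conv_of_real)
end


type_synonym 'a op = "'a \<Rightarrow>\<^sub>L 'a"

text \<open>Type \<open>'a op\<close> contains all bounded real-linear maps; \<open>B(H)\<close> is the set of
  those that are complex-linear.\<close>

definition BH :: "'a::complex_hilbert_space op set" where
  "BH = {T. \<forall>a x. blinfun_apply T (a *\<^sub>C x) = a *\<^sub>C blinfun_apply T x}"

text \<open>The inequality \<open>0 \<le> z\<close> on complex numbers says that \<open>z\<close> is real and nonnegative.\<close>

definition positive_op :: "'a::complex_hilbert_space op \<Rightarrow> bool" where
  "positive_op A \<longleftrightarrow> A \<in> BH \<and> (\<forall>x. 0 \<le> cinner x (blinfun_apply A x))"

definition op_le :: "'a::complex_hilbert_space op \<Rightarrow> 'a op \<Rightarrow> bool" (infix "\<preceq>" 50) where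
  "A \<preceq> B \<longleftrightarrow> positive_op (B - A)"

definition is_inverse_op :: "'a::complex_hilbert_space op \<Rightarrow> 'a op \<Rightarrow> bool" where
  "is_inverse_op A B \<longleftrightarrow> A o\<^sub>L B = id_blinfun \<and> B o\<^sub>L A = id_blinfun"

definition strictly_positive_op :: "'a::complex_hilbert_space op \<Rightarrow> bool" where
  "strictly_positive_op A \<longleftrightarrow> positive_op A \<and> (\<exists>B\<in>BH. is_inverse_op A B)"

definition inverse_op :: "'a::complex_hilbert_space op \<Rightarrow> 'a op" where
  "inverse_op A = (THE B. is_inverse_op A B)"

definition strong_limit ::
    "('i \<Rightarrow> 'a::complex_hilbert_space op) \<Rightarrow> 'a op \<Rightarrow> 'i filter \<Rightarrow> bool" where
  "strong_limit T L F \<longleftrightarrow> (\<forall>x. ((\<lambda>i. blinfun_apply (T i) x) \<longlongrightarrow> blinfun_apply L x) F)"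

definition decreases_to :: "(nat \<Rightarrow> 'a::complex_hilbert_space op) \<Rightarrow> 'a op \<Rightarrow> bool" (infix "\<down>" 50) where
  "T \<down> L \<longleftrightarrow> (\<forall>n. T (Suc n) \<preceq> T n) \<and> strong_limit T L sequentially"


text \<open>Only the values of \<open>\<sigma>\<close> at pairs of positive operators are relevant.\<close>

definition connection :: "('a::complex_hilbert_space op \<Rightarrow> 'a op \<Rightarrow> 'a op) \<Rightarrow> bool" where
  "connection \<sigma> \<longleftrightarrow>
     (\<forall>A B. positive_op A \<longrightarrow> positive_op B \<longrightarrow> positive_op (\<sigma> A B)) \<and>
     (\<forall>A B C D. positive_op A \<longrightarrow> positive_op B \<longrightarrow> positive_op C \<longrightarrow> positive_op D \<longrightarrow>
        A \<preceq> C \<longrightarrow> B \<preceq> D \<longrightarrow> \<sigma> A B \<preceq> \<sigma> C D) \<and>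
     (\<forall>A B C. positive_op A \<longrightarrow> positive_op B \<longrightarrow> positive_op C \<longrightarrow>
        C o\<^sub>L \<sigma> A B o\<^sub>L C \<preceq> \<sigma> (C o\<^sub>L A o\<^sub>L C) (C o\<^sub>L B o\<^sub>L C)) \<and>
     (\<forall>S T A B. (\<forall>n. positive_op (S n)) \<longrightarrow> (\<forall>n. positive_op (T n)) \<longrightarrow>
        positive_op A \<longrightarrow> positive_op B \<longrightarrow>
        S \<down> A \<longrightarrow> T \<down> B \<longrightarrow> (\<lambda>n. \<sigma> (S n) (T n)) \<down> \<sigma> A B)"


definition op_power :: "'a::complex_hilbert_space op \<Rightarrow> nat \<Rightarrow> 'a op" where
  "op_power A n = ((\<lambda>T. A o\<^sub>L T) ^^ n) id_blinfun"

definition op_poly :: "real poly \<Rightarrow> 'a::complex_hilbert_space op \<Rightarrow> 'a op" where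
  "op_poly p A = (\<Sum>i\<le>degree p. coeff p i *\<^sub>R op_power A i)"

text \<open>Continuous functional calculus for positive \<open>A\<close> and \<open>f\<close> continuous on
  \<open>[0,\<infinity>)\<close>: the spectrum of \<open>A\<close> lies in the interval \<open>[0, norm A]\<close>, so
  \<open>f(A)\<close> is the norm limit of \<open>p\<^sub>n(A)\<close> for any polynomials \<open>p\<^sub>n\<close>
  converging to \<open>f\<close> uniformly there.\<close>

definition cfc :: "(real \<Rightarrow> real) \<Rightarrow> 'a::complex_hilbert_space op \<Rightarrow> 'a op" where
  "cfc f A = (THE T. \<exists>p. uniform_limit {0..norm A} (\<lambda>n. poly (p n)) f sequentially \<and>
                       (\<lambda>n. op_poly (p n) A) \<longlonglongrightarrow> T)"

text \<open>Functions on \<open>[0,\<infinity>)\<close> are represented by functions on the reals whose values at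
  negative arguments are irrelevant. The Hilbert space on which monotonicity is tested is
  the type argument, as one cannot quantify over all Hilbert spaces inside a formula.\<close>

definition operator_monotone :: "'a::complex_hilbert_space itself \<Rightarrow> (real \<Rightarrow> real) \<Rightarrow> bool" where
  "operator_monotone _ f \<longleftrightarrow>
     f \<in> {0..} \<rightarrow> {0..} \<and> continuous_on {0..} f \<and>
     (\<forall>A B :: 'a op. positive_op A \<longrightarrow> positive_op B \<longrightarrow> A \<preceq> B \<longrightarrow> cfc f A \<preceq> cfc f B)"

definition representing_function ::
    "('a::complex_hilbert_space op \<Rightarrow> 'a op \<Rightarrow> 'a op) \<Rightarrow> (real \<Rightarrow> real) \<Rightarrow> bool" where
  "representing_function \<sigma> f \<longleftrightarrow>
     operator_monotone TYPE('a) f \<and>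
     (\<forall>x\<ge>0. f x *\<^sub>R id_blinfun = \<sigma> id_blinfun (x *\<^sub>R id_blinfun))"


definition harmonic_strict ::
    "real \<Rightarrow> 'a::complex_hilbert_space op \<Rightarrow> 'a op \<Rightarrow> 'a op" where
  "harmonic_strict t A B = inverse_op ((1 - t) *\<^sub>R inverse_op A + t *\<^sub>R inverse_op B)"

definition harmonic_mean ::
    "real \<Rightarrow> 'a::complex_hilbert_space op \<Rightarrow> 'a op \<Rightarrow> 'a op" where
  "harmonic_mean t A B =
     (THE L. strong_limit
        (\<lambda>\<epsilon>. harmonic_strict t (A + \<epsilon> *\<^sub>R id_blinfun) (B + \<epsilon> *\<^sub>R id_blinfun)) L (at_right 0))"

abbreviation unit_borel :: "real measure" where
  "unit_borel \<equiv> restrict_space borel {0..1}"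

text \<open>Operator-valued integrals are taken weakly: the Bochner integral of the library
  needs a second countable target, which an operator space in general is not.\<close>

definition has_weak_integral ::
    "real measure \<Rightarrow> (real \<Rightarrow> 'a::complex_hilbert_space op) \<Rightarrow> 'a op \<Rightarrow> bool" where
  "has_weak_integral \<mu> F T \<longleftrightarrow>
     (\<forall>x y. has_bochner_integral \<mu> (\<lambda>t. cinner x (blinfun_apply (F t) y))
              (cinner x (blinfun_apply T y)))"

definition associated_measure ::
    "('a::complex_hilbert_space op \<Rightarrow> 'a op \<Rightarrow> 'a op) \<Rightarrow> real measure \<Rightarrow> bool" where
  "associated_measure \<sigma> \<mu> \<longleftrightarrow>
     sets \<mu> = sets unit_borel \<and> finite_measure \<mu> \<and>
     (\<forall>A B. positive_op A \<longrightarrow> positive_op B \<longrightarrow>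
        has_weak_integral \<mu> (\<lambda>t. harmonic_mean t A B) (\<sigma> A B))"


definition left_cancellable_connection ::
    "('a::complex_hilbert_space op \<Rightarrow> 'a op \<Rightarrow> 'a op) \<Rightarrow> bool" where
  "left_cancellable_connection \<sigma> \<longleftrightarrow>
     (\<forall>A B C. strictly_positive_op A \<longrightarrow> positive_op B \<longrightarrow> positive_op C \<longrightarrow>
        \<sigma> A B = \<sigma> A C \<longrightarrow> B = C)"

definition multiple_of_left_trivial ::
    "('a::complex_hilbert_space op \<Rightarrow> 'a op \<Rightarrow> 'a op) \<Rightarrow> bool" where
  "multiple_of_left_trivial \<sigma> \<longleftrightarrow>
     (\<exists>k::real. 0 \<le> k \<and> (\<forall>A B. positive_op A \<longrightarrow> positive_op B \<longrightarrow> \<sigma> A B = k *\<^sub>R A))"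

text \<open>The common domain \<open>X\<close> of \<open>g\<close> and \<open>h\<close> ranges over the subsets of the type argument.\<close>

definition left_cancellable_function :: "'x itself \<Rightarrow> (real \<Rightarrow> real) \<Rightarrow> bool" where
  "left_cancellable_function _ f \<longleftrightarrow>
     (\<forall>(X :: 'x set) g h. g \<in> X \<rightarrow> {0..} \<longrightarrow> h \<in> X \<rightarrow> {0..} \<longrightarrow>
        (\<forall>x\<in>X. f (g x) = f (h x)) \<longrightarrow> (\<forall>x\<in>X. g x = h x))"

definition multiple_of_dirac_0 :: "real measure \<Rightarrow> bool" where
  "multiple_of_dirac_0 \<mu> \<longleftrightarrow>
     (\<exists>k::real. 0 \<le> k \<and> \<mu> = scale_measure (ennreal k) (return unit_borel 0))"

end

theory Submission
  imports Defs "HOL-Computational_Algebra.Fundamental_Theorem_Algebra"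
begin

text \<open>Write \<open>m\<^sub>t(x) = 1 !\<^sub>t x\<close>, so that \<open>f(x) = \<integral> m\<^sub>t(x) d\<mu>(t)\<close>. Each \<open>m\<^sub>t\<close> with \<open>t > 0\<close> is strictly
  increasing and \<open>m\<^sub>0 = 1\<close>; hence \<open>f\<close> is injective unless \<open>\<mu>\<close> is concentrated at \<open>0\<close>, in which
  case \<open>\<sigma>\<close> is a multiple of the left-trivial mean and \<open>f\<close> is constant. If \<open>f\<close> is injective, \<open>A\<close>
  is recovered from \<open>I \<sigma> A = f(A)\<close> by applying polynomials that approximate the inverse function
  of \<open>f\<close>. A general \<open>A > 0\<close> reduces to \<open>I\<close> because (M2) is an equality for invertible \<open>C\<close>,
  here \<open>C = A\<^sup>-\<^sup>1\<^sup>/\<^sup>2\<close>.\<close>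

section \<open>Operators and polynomials in a positive operator\<close>

text \<open>The obstacle is that \<open>f(A)\<close> is given only as a norm limit of polynomials in
  \<open>A\<close>. Existence, uniqueness and all estimates of this calculus rest on one inequality:
  the norm of \<open>p(A)\<close> is at most the maximum of the absolute value of \<open>p\<close>
  on \<open>[0, norm A]\<close>. It is obtained without a spectral theorem, by factoring a
  polynomial over the complex numbers and bounding each linear factor from below. The representing
  function prescribes \<open>\<sigma> I (x I)\<close> for scalars \<open>x\<close> only, and the
  measure prescribes \<open>\<sigma>\<close> only weakly; the identity
  \<open>\<sigma> I A = f(A)\<close> is derived by combining the two. Harmonic means are definite
  descriptions of strong limits. They are computed in two cases: \<open>t = 0\<close>, and first
  argument \<open>I\<close>, where every operator in the formula is a function of the single
  operator \<open>A\<close>. A nonzero vector is assumed because on the zero space all operators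
  coincide, so that \<open>\<sigma>\<close> says nothing about \<open>f\<close>.\<close>

instance complex_hilbert_space \<subseteq> banach ..

section \<open>Complex scalars and the complex inner product\<close>

lemma scaleC_zero_right [simp]: "a *\<^sub>C (0::'a::complex_hilbert_space) = 0"
  using scaleC_add_right[of a "0::'a" 0] by simp

lemma scaleC_zero_left [simp]: "0 *\<^sub>C (x::'a::complex_hilbert_space) = 0"
  using scaleC_of_real[of 0 x] by simp

lemma scaleC_minus_left: "(- a) *\<^sub>C (x::'a::complex_hilbert_space) = - (a *\<^sub>C x)"
  using scaleC_add_left[of a "- a" x] by (simp add: add_eq_0_iff2)

lemma scaleC_scaleR: "a *\<^sub>C (r *\<^sub>R (x::'a::complex_hilbert_space)) = r *\<^sub>R (a *\<^sub>C x)"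
  by (metis scaleC_of_real scaleC_scaleC mult.commute)

lemma cinner_add_left: "cinner (x + y) (z::'a::complex_hilbert_space) = cinner x z + cinner y z"
  by (metis cinner_commute cinner_add_right complex_cnj_add)

lemma cinner_scaleC_left: "cinner (a *\<^sub>C x) (y::'a::complex_hilbert_space) = cnj a * cinner x y"
  by (metis cinner_commute cinner_scaleC_right complex_cnj_mult)

lemma cinner_self: "cinner x (x::'a::complex_hilbert_space) = of_real ((norm x)\<^sup>2)"
proof (rule complex_eqI)
  have "Im (cinner x x) = - Im (cinner x x)"
    using arg_cong[OF cinner_commute[of x x], of Im] by simp
  then show "Im (cinner x x) = Im (of_real ((norm x)\<^sup>2))" by simp
qed (simp add: Re_cinner power2_norm_eq_inner)

lemma norm_scaleC: "norm (a *\<^sub>C (x::'a::complex_hilbert_space)) = cmod a * norm x"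
proof -
  have "complex_of_real ((norm (a *\<^sub>C x))\<^sup>2) = a * cnj a * of_real ((norm x)\<^sup>2)"
    by (simp only: cinner_scaleC_left cinner_scaleC_right mult_ac flip: cinner_self)
  also have "\<dots> = of_real ((cmod a * norm x)\<^sup>2)"
    by (simp only: power_mult_distrib of_real_mult flip: complex_norm_square)
  finally have "(norm (a *\<^sub>C x))\<^sup>2 = (cmod a * norm x)\<^sup>2"
    by (simp only: of_real_eq_iff)
  then show ?thesis by (simp add: power2_eq_iff_nonneg)
qed

lemma tendsto_scaleC:
  fixes f :: "'i \<Rightarrow> 'a::complex_hilbert_space"
  assumes "(f \<longlongrightarrow> l) F"
  shows "((\<lambda>i. a *\<^sub>C f i) \<longlongrightarrow> a *\<^sub>C l) F"
proof -
  have "bounded_linear (\<lambda>x::'a. a *\<^sub>C x)"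
    by (rule bounded_linear_intro[where K = "cmod a"])
      (simp_all add: scaleC_add_right scaleC_scaleR norm_scaleC mult.commute)
  then show ?thesis using assms by (rule bounded_linear.tendsto)
qed

lemma BH_scaleC: "A \<in> BH \<Longrightarrow> blinfun_apply A (a *\<^sub>C x) = a *\<^sub>C blinfun_apply A x"
  by (simp add: BH_def)

lemma BH_id [simp]: "id_blinfun \<in> BH"
  and BH_zero [simp]: "0 \<in> BH"
  and BH_add: "A \<in> BH \<Longrightarrow> B \<in> BH \<Longrightarrow> A + B \<in> BH"
  and BH_scaleR: "A \<in> BH \<Longrightarrow> r *\<^sub>R A \<in> BH"
  and BH_compose: "A \<in> BH \<Longrightarrow> B \<in> BH \<Longrightarrow> A o\<^sub>L B \<in> BH"
  by (auto simp: BH_def blinfun.bilinear_simps scaleC_add_right scaleC_scaleR)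

lemma BH_closed:
  assumes "T \<longlonglongrightarrow> L" and "\<And>n. T n \<in> BH"
  shows "L \<in> BH"
  unfolding BH_def
proof (intro CollectI allI)
  fix a x
  have app: "(\<lambda>n. blinfun_apply (T n) y) \<longlonglongrightarrow> blinfun_apply L y" for y
    by (intro tendsto_intros assms)
  have "(\<lambda>n. blinfun_apply (T n) (a *\<^sub>C x)) \<longlonglongrightarrow> a *\<^sub>C blinfun_apply L x"
    using tendsto_scaleC[OF app[of x], of a] assms(2) by (simp add: BH_scaleC)
  with app show "blinfun_apply L (a *\<^sub>C x) = a *\<^sub>C blinfun_apply L x"
    using LIMSEQ_unique by blast
qed

section \<open>Symmetric and positive operators\<close>

definition symmetric_op :: "'a::complex_hilbert_space op \<Rightarrow> bool" where
  "symmetric_op A \<longleftrightarrow> (\<forall>x y. inner (blinfun_apply A x) y = inner x (blinfun_apply A y))"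

lemma symmetric_opD: "symmetric_op A \<Longrightarrow> inner (blinfun_apply A x) y = inner x (blinfun_apply A y)"
  by (simp add: symmetric_op_def)

text \<open>Reduces positivity to the real inner product. The imaginary part of
  \<open>cinner u v\<close> is the real inner product of \<open>u\<close> with \<open>-i v\<close>,
  so complex linearity and symmetry make the imaginary part of \<open>cinner x (A x)\<close> its own
  negative.\<close>

lemma positive_opI:
  fixes A :: "'a::complex_hilbert_space op"
  assumes BH: "A \<in> BH" and sym: "symmetric_op A" and nonneg: "\<And>x. 0 \<le> inner x (blinfun_apply A x)"
  shows "positive_op A"
  unfolding positive_op_def
proof (intro conjI allI BH)
  fix x :: 'a
  have Im: "Im (cinner u v) = inner u ((- \<i>) *\<^sub>C v)" for u v :: 'a
    by (simp add: cinner_scaleC_right flip: Re_cinner)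
  have "Im (cinner x (blinfun_apply A x)) = Im (cinner (blinfun_apply A x) x)"
    by (simp only: Im BH_scaleC[OF BH, symmetric] symmetric_opD[OF sym])
  also have "\<dots> = - Im (cinner x (blinfun_apply A x))"
    using arg_cong[OF cinner_commute[of "blinfun_apply A x" x], of Im] by simp
  finally have "Im (cinner x (blinfun_apply A x)) = 0" by simp
  then show "0 \<le> cinner x (blinfun_apply A x)"
    using nonneg[of x] by (simp add: less_eq_complex_def Re_cinner)
qed

lemma positive_op_BH: "positive_op A \<Longrightarrow> A \<in> BH"
  by (simp add: positive_op_def)

lemma positive_op_inner_nonneg: "positive_op A \<Longrightarrow> 0 \<le> inner x (blinfun_apply A x)"
  by (simp add: positive_op_def less_eq_complex_def Re_cinner)

text \<open>Complex polarization: the defect \<open>h\<close> of symmetry vanishes on the diagonal,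
  so \<open>h x y + h y x = 0\<close>; putting \<open>i y\<close> for \<open>y\<close> turns the sum
  into a difference, and together they give \<open>h x y = 0\<close>.\<close>

lemma positive_op_symmetric:
  fixes A :: "'a::complex_hilbert_space op"
  assumes A: "positive_op A"
  shows "symmetric_op A"
proof -
  note BH = positive_op_BH[OF A]
  define h where "h x y = cinner x (blinfun_apply A y) - cinner (blinfun_apply A x) y" for x y
  have diag: "h x x = 0" for x
  proof -
    have "cinner (blinfun_apply A x) x = cnj (cinner x (blinfun_apply A x))"
      by (rule cinner_commute)
    also have "\<dots> = cinner x (blinfun_apply A x)"
      using A by (auto simp: positive_op_def less_eq_complex_def complex_eq_iff)
    finally show ?thesis by (simp add: h_def)
  qed
  have add: "h (x + y) (x + y) = h x x + h x y + h y x + h y y" for x y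
    by (simp add: h_def blinfun.add_right cinner_add_left cinner_add_right)
  have rot: "h x (\<i> *\<^sub>C y) = \<i> * h x y" "h (\<i> *\<^sub>C y) x = - \<i> * h y x" for x y
    by (simp_all add: h_def BH_scaleC[OF BH] cinner_scaleC_left cinner_scaleC_right algebra_simps)
  have "h x y = 0" for x y
  proof -
    have "h x y + h y x = 0" using add[of x y] by (simp add: diag)
    moreover have "\<i> * h x y - \<i> * h y x = 0"
      using add[of x "\<i> *\<^sub>C y"] by (simp only: rot diag) simp
    ultimately show ?thesis by (simp flip: right_diff_distrib)
  qed
  then show ?thesis
    by (simp add: symmetric_op_def h_def flip: Re_cinner)
qed

lemma positive_op_iff:
  "positive_op A \<longleftrightarrow> A \<in> BH \<and> symmetric_op A \<and> (\<forall>x. 0 \<le> inner x (blinfun_apply A x))"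
  by (auto intro: positive_opI positive_op_BH positive_op_symmetric positive_op_inner_nonneg)

lemma symmetric_op_id [simp]: "symmetric_op id_blinfun"
  and symmetric_op_zero [simp]: "symmetric_op 0"
  and symmetric_op_add: "symmetric_op A \<Longrightarrow> symmetric_op B \<Longrightarrow> symmetric_op (A + B)"
  and symmetric_op_scaleR: "symmetric_op A \<Longrightarrow> symmetric_op (r *\<^sub>R A)"
  by (auto simp: symmetric_op_def blinfun.bilinear_simps inner_add_left inner_add_right)

lemma symmetric_op_compose:
  "symmetric_op A \<Longrightarrow> symmetric_op B \<Longrightarrow> A o\<^sub>L B = B o\<^sub>L A \<Longrightarrow> symmetric_op (A o\<^sub>L B)"
  by (simp add: symmetric_op_def) (metis blinfun_apply_blinfun_compose)

lemma symmetric_op_closed: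
  assumes "T \<longlonglongrightarrow> L" and "\<And>n. symmetric_op (T n)"
  shows "symmetric_op L"
  unfolding symmetric_op_def
proof (intro allI)
  fix x y
  have "(\<lambda>n. inner (blinfun_apply (T n) x) y) \<longlonglongrightarrow> inner (blinfun_apply L x) y"
    "(\<lambda>n. inner x (blinfun_apply (T n) y)) \<longlonglongrightarrow> inner x (blinfun_apply L y)"
    by (intro tendsto_intros assms)+
  then show "inner (blinfun_apply L x) y = inner x (blinfun_apply L y)"
    using assms(2) LIMSEQ_unique by (simp add: symmetric_op_def)
qed

lemma positive_op_id [simp]: "positive_op id_blinfun"
  and positive_op_zero [simp]: "positive_op 0"
  and positive_op_scaleR: "0 \<le> r \<Longrightarrow> positive_op A \<Longrightarrow> positive_op (r *\<^sub>R A)"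
  by (auto simp: positive_op_iff BH_scaleR symmetric_op_scaleR blinfun.bilinear_simps)

lemma blinfun_compose_id [simp]: "A o\<^sub>L id_blinfun = A" "id_blinfun o\<^sub>L A = A"
  by (auto intro: blinfun_eqI)

lemma blinfun_compose_assoc: "(A o\<^sub>L B) o\<^sub>L C = A o\<^sub>L (B o\<^sub>L C)"
  by (auto intro: blinfun_eqI)

lemmas blinfun_compose_simps =
  bounded_bilinear.add_left[OF bounded_bilinear_blinfun_compose]
  bounded_bilinear.add_right[OF bounded_bilinear_blinfun_compose]
  bounded_bilinear.diff_left[OF bounded_bilinear_blinfun_compose]
  bounded_bilinear.diff_right[OF bounded_bilinear_blinfun_compose]
  bounded_bilinear.scaleR_left[OF bounded_bilinear_blinfun_compose]
  bounded_bilinear.scaleR_right[OF bounded_bilinear_blinfun_compose]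

section \<open>Real polynomials of an operator\<close>

lemma op_power_0 [simp]: "op_power A 0 = id_blinfun"
  and op_power_Suc [simp]: "op_power A (Suc n) = A o\<^sub>L op_power A n"
  by (simp_all add: op_power_def)

lemma op_poly_altdef:
  assumes "degree p \<le> n"
  shows "op_poly p A = (\<Sum>i\<le>n. coeff p i *\<^sub>R op_power A i)"
  unfolding op_poly_def
  by (rule sum.mono_neutral_left) (use assms in \<open>auto simp: coeff_eq_0\<close>)

lemma op_poly_0 [simp]: "op_poly 0 A = 0"
  by (simp add: op_poly_def)

lemma op_poly_pCons [simp]: "op_poly (pCons a p) A = a *\<^sub>R id_blinfun + (A o\<^sub>L op_poly p A)"
proof -
  have "op_poly (pCons a p) A = (\<Sum>i\<le>Suc (degree p). coeff (pCons a p) i *\<^sub>R op_power A i)"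
    by (rule op_poly_altdef) (simp add: degree_pCons_le)
  also have "\<dots> = a *\<^sub>R id_blinfun + (A o\<^sub>L op_poly p A)"
    unfolding op_poly_def by (subst sum.atMost_Suc_shift)
      (simp add: blinfun_compose_simps bounded_bilinear.sum_right[OF bounded_bilinear_blinfun_compose])
  finally show ?thesis .
qed

lemma op_poly_add: "op_poly (p + q) A = op_poly p A + op_poly q A"
  by (induction p q rule: poly_induct2) (simp_all add: blinfun_compose_simps scaleR_left_distrib)

lemma op_poly_smult: "op_poly (smult c p) A = c *\<^sub>R op_poly p A"
  by (induction p) (simp_all add: blinfun_compose_simps scaleR_right_distrib)

lemma op_poly_diff: "op_poly (p - q) A = op_poly p A - op_poly q A"
  using op_poly_add[of p "- q" A] op_poly_smult[of "- 1" q A] by simp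

lemma op_poly_mult: "op_poly (p * q) A = op_poly p A o\<^sub>L op_poly q A"
  by (induction p)
    (simp_all add: op_poly_add op_poly_smult blinfun_compose_simps blinfun_compose_assoc)

lemma op_poly_BH: "A \<in> BH \<Longrightarrow> op_poly p A \<in> BH"
  by (induction p) (simp_all add: BH_add BH_scaleR BH_compose)

lemma op_poly_commute: "op_poly p A o\<^sub>L op_poly q A = op_poly q A o\<^sub>L op_poly p A"
  by (metis op_poly_mult mult.commute)

lemma op_poly_symmetric: "symmetric_op A \<Longrightarrow> symmetric_op (op_poly p A)"
proof (induction p)
  case (pCons a p)
  have "A o\<^sub>L op_poly p A = op_poly p A o\<^sub>L A"
    using op_poly_commute[of "[:0, 1:]" A p] by simp
  then show ?case
    using pCons by (simp add: symmetric_op_add symmetric_op_scaleR symmetric_op_compose)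
qed simp

lemma op_poly_scaleR_id: "op_poly p (x *\<^sub>R id_blinfun) = poly p x *\<^sub>R id_blinfun"
  by (induction p) (simp_all add: blinfun_compose_simps scaleR_left_distrib)

text \<open>Operators of type \<open>'a op\<close> form a real vector space, so complex coefficients
  are made to act on the vector. They are needed to split a real polynomial into linear
  factors.\<close>

definition cop_poly :: "complex poly \<Rightarrow> 'a::complex_hilbert_space op \<Rightarrow> 'a \<Rightarrow> 'a" where
  "cop_poly p A x = (\<Sum>i\<le>degree p. coeff p i *\<^sub>C blinfun_apply (op_power A i) x)"

lemma cop_poly_0 [simp]: "cop_poly 0 A x = 0"
  by (simp add: cop_poly_def)

lemma cop_poly_pCons:
  assumes "A \<in> BH"
  shows "cop_poly (pCons a p) A x = a *\<^sub>C x + blinfun_apply A (cop_poly p A x)"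
proof -
  have "cop_poly (pCons a p) A x
      = (\<Sum>i\<le>Suc (degree p). coeff (pCons a p) i *\<^sub>C blinfun_apply (op_power A i) x)"
    unfolding cop_poly_def
    by (rule sum.mono_neutral_left) (use degree_pCons_le[of a p] in \<open>auto simp: coeff_eq_0\<close>)
  also have "\<dots> = a *\<^sub>C x + blinfun_apply A (cop_poly p A x)"
    unfolding cop_poly_def by (subst sum.atMost_Suc_shift)
      (simp add: blinfun.sum_right BH_scaleC[OF assms])
  finally show ?thesis .
qed

lemma cop_poly_add:
  "A \<in> BH \<Longrightarrow> cop_poly (p + q) A x = cop_poly p A x + cop_poly q A x"
  by (induction p q rule: poly_induct2)
    (simp_all add: cop_poly_pCons scaleC_add_left blinfun.add_right)

lemma cop_poly_smult: "A \<in> BH \<Longrightarrow> cop_poly (smult c p) A x = c *\<^sub>C cop_poly p A x"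
  by (induction p) (simp_all add: cop_poly_pCons scaleC_add_right scaleC_scaleC BH_scaleC)

lemma cop_poly_of_real:
  "A \<in> BH \<Longrightarrow> cop_poly (map_poly of_real p) A x = blinfun_apply (op_poly p A) x"
  by (induction p)
    (simp_all add: map_poly_pCons cop_poly_pCons scaleC_of_real blinfun.bilinear_simps)

lemma positive_op_inner_le:
  assumes "positive_op A"
  shows "inner x (blinfun_apply A x) \<le> norm A * (norm x)\<^sup>2"
proof -
  have "inner x (blinfun_apply A x) \<le> norm x * norm (blinfun_apply A x)"
    by (rule norm_cauchy_schwarz)
  also have "\<dots> \<le> norm x * (norm A * norm x)"
    by (intro mult_left_mono norm_blinfun) simp
  finally show ?thesis by (simp add: power2_eq_square mult_ac)
qed

text \<open>For real \<open>z\<close> the quadratic form of \<open>A\<close> lies between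
  \<open>0\<close> and \<open>norm A\<close> times the squared norm, so Cauchy-Schwarz leaves a gap
  of the size of the distance from \<open>z\<close> to the interval. For nonreal \<open>z\<close>
  the vectors \<open>A x - a x\<close> and \<open>i b x\<close> are orthogonal in the real inner
  product, and Pythagoras gives the bound by the imaginary part \<open>b\<close>.\<close>

lemma linear_factor_bounded_below:
  fixes A :: "'a::complex_hilbert_space op"
  assumes A: "positive_op A" and z: "z \<notin> of_real ` {0..norm A}"
  obtains c where "c > 0" "\<And>x. c * norm x \<le> norm (blinfun_apply A x - z *\<^sub>C x)"
proof -
  define a b where "a = Re z" and "b = Im z"
  have zab: "z *\<^sub>C x = a *\<^sub>R x + (\<i> * of_real b) *\<^sub>C x" for x :: 'a
    using scaleC_add_left[of "of_real a" "\<i> * of_real b" x]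
    by (simp add: a_def b_def scaleC_of_real flip: complex_eq)
  show ?thesis
  proof (cases "b = 0")
    case True
    have sub: "c * norm x \<le> norm (blinfun_apply A x - z *\<^sub>C x)"
      if "c * (norm x)\<^sup>2 \<le> \<bar>inner x (blinfun_apply A x - a *\<^sub>R x)\<bar>" for c x
    proof (cases "x = 0")
      case False
      have "c * (norm x)\<^sup>2 \<le> norm x * norm (blinfun_apply A x - a *\<^sub>R x)"
        using that Cauchy_Schwarz_ineq2[of x "blinfun_apply A x - a *\<^sub>R x"] by linarith
      with False have "c * norm x \<le> norm (blinfun_apply A x - a *\<^sub>R x)"
        by (simp add: power2_eq_square mult_ac)
      then show ?thesis using True by (simp add: zab)
    qed simp
    have "a < 0 \<or> norm A < a"
    proof (rule ccontr)
      assume "\<not> ?thesis"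
      then have "a \<in> {0..norm A}" by simp
      moreover have "z = of_real a" using True by (simp add: a_def b_def complex_eq_iff)
      ultimately show False using z by blast
    qed
    then show ?thesis
    proof
      assume "a < 0"
      show ?thesis
      proof (rule that[of "- a"])
        show "- a * norm x \<le> norm (blinfun_apply A x - z *\<^sub>C x)" for x
          by (rule sub) (use positive_op_inner_nonneg[OF A, of x] \<open>a < 0\<close> in
            \<open>simp add: inner_diff_right flip: power2_norm_eq_inner\<close>)
      qed (use \<open>a < 0\<close> in simp)
    next
      assume "norm A < a"
      show ?thesis
      proof (rule that[of "a - norm A"])
        show "(a - norm A) * norm x \<le> norm (blinfun_apply A x - z *\<^sub>C x)" for x
          by (rule sub) (use positive_op_inner_le[OF A, of x] in
            \<open>simp add: inner_diff_right algebra_simps flip: power2_norm_eq_inner\<close>)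
      qed (use \<open>norm A < a\<close> in simp)
    qed
  next
    case False
    show ?thesis
    proof (rule that[of "\<bar>b\<bar>"])
      fix x :: 'a
      define u v where "u = blinfun_apply A x - a *\<^sub>R x" and "v = (\<i> * of_real b) *\<^sub>C x"
      have "Im (cinner x (blinfun_apply A x)) = 0"
        using A by (simp add: positive_op_def less_eq_complex_def)
      then have "inner (blinfun_apply A x) v = 0"
        using cinner_commute[of x "blinfun_apply A x"]
        by (simp add: v_def cinner_scaleC_right complex_eq_iff flip: Re_cinner)
      moreover have "inner x v = 0"
        by (simp add: v_def cinner_scaleC_right cinner_self flip: Re_cinner)
      ultimately have "inner u v = 0" by (simp add: u_def inner_diff_left)
      then have "(norm (u - v))\<^sup>2 = (norm u)\<^sup>2 + (norm v)\<^sup>2"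
        by (simp add: power2_norm_eq_inner inner_diff_left inner_diff_right inner_commute)
      then have "(norm v)\<^sup>2 \<le> (norm (u - v))\<^sup>2"
        using zero_le_power2[of "norm u"] by linarith
      then have "norm v \<le> norm (u - v)"
        by (rule power2_le_imp_le) simp
      then show "\<bar>b\<bar> * norm x \<le> norm (blinfun_apply A x - z *\<^sub>C x)"
        by (simp add: zab u_def v_def norm_scaleC norm_mult diff_diff_eq)
    qed (use False in simp)
  qed
qed

text \<open>Split off one root at a time: roots avoid the interval, so each linear factor is bounded
  below, and lower bounds multiply. Bounds from below replace invertibility, hence no surjectivity
  has to be shown.\<close>

lemma cop_poly_bounded_below:
  fixes A :: "'a::complex_hilbert_space op"
  assumes A: "positive_op A"
    and "\<And>r. r \<in> {0..norm A} \<Longrightarrow> poly p (of_real r) \<noteq> 0"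
  shows "\<exists>c>0. \<forall>x. c * norm x \<le> norm (cop_poly p A x)"
  using assms(2)
proof (induction "degree p" arbitrary: p)
  case 0
  note BH = positive_op_BH[OF A]
  from 0 obtain a where p: "p = [:a:]" by (metis degree_eq_zeroE)
  with 0 have "a \<noteq> 0" by fastforce
  then show ?case
    by (intro exI[of _ "cmod a"]) (simp add: p cop_poly_pCons[OF BH] norm_scaleC)
next
  case (Suc n)
  note BH = positive_op_BH[OF A]
  have "\<not> constant (poly p)" using Suc.hyps(2) by (simp add: constant_degree)
  then obtain z where z: "poly p z = 0" using fundamental_theorem_of_algebra by blast
  then obtain q where p: "p = [:- z, 1:] * q" by (auto simp: poly_eq_0_iff_dvd dvd_def)
  have "q \<noteq> 0" using p Suc.hyps(2) by auto
  then have "n = degree q" using Suc.hyps(2) unfolding p by (subst (asm) degree_mult_eq) auto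
  moreover have "poly q (of_real r) \<noteq> 0" if "r \<in> {0..norm A}" for r
    using Suc.prems[OF that] by (simp add: p)
  ultimately obtain c where c: "c > 0" "\<And>x. c * norm x \<le> norm (cop_poly q A x)"
    using Suc.hyps(1) by blast
  have "z \<notin> of_real ` {0..norm A}" using z Suc.prems by auto
  then obtain d where d: "d > 0" "\<And>x. d * norm x \<le> norm (blinfun_apply A x - z *\<^sub>C x)"
    using linear_factor_bounded_below[OF A] by metis
  have "p = pCons 0 q + smult (- z) q" by (simp add: p)
  then have eq: "cop_poly p A x = blinfun_apply A (cop_poly q A x) - z *\<^sub>C cop_poly q A x" for x
    by (simp only: cop_poly_add[OF BH] cop_poly_smult[OF BH] cop_poly_pCons[OF BH]
        scaleC_minus_left scaleC_zero_left add_0 add_uminus_conv_diff)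
  have "d * c * norm x \<le> norm (cop_poly p A x)" for x
  proof -
    have "d * c * norm x \<le> d * norm (cop_poly q A x)"
      using c(2)[of x] d(1) by simp
    also have "\<dots> \<le> norm (cop_poly p A x)" unfolding eq by (rule d(2))
    finally show ?thesis .
  qed
  then show ?case using c(1) d(1) by (intro exI[of _ "d * c"]) simp
qed

text \<open>If \<open>S = p(A)\<close> had norm \<open>s > K\<close>, then \<open>p\<^sup>2 - s\<^sup>2\<close> would have no zero on
  \<open>[0, norm A]\<close> and \<open>S\<^sup>2 - s\<^sup>2\<close> would be bounded below; but it is not, because
  \<open>S\<close> is symmetric and almost attains its norm.\<close>

lemma norm_op_poly_le:
  fixes A :: "'a::complex_hilbert_space op"
  assumes A: "positive_op A" and K: "\<And>r. r \<in> {0..norm A} \<Longrightarrow> \<bar>poly p r\<bar> \<le> K"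
  shows "norm (op_poly p A) \<le> K"
proof (rule ccontr)
  define S s where "S = op_poly p A" and "s = norm S"
  assume "\<not> norm (op_poly p A) \<le> K"
  then have s: "K < s" by (simp add: S_def s_def)
  have "0 \<le> K" using K[of 0] by simp
  with s have s0: "0 < s" by simp
  note BH = positive_op_BH[OF A]
  have sym: "symmetric_op S"
    unfolding S_def by (rule op_poly_symmetric[OF positive_op_symmetric[OF A]])
  define q where "q = p * p - [:s\<^sup>2:]"
  have "poly (map_poly of_real q) (complex_of_real r) \<noteq> 0" if "r \<in> {0..norm A}" for r
  proof -
    have "\<bar>poly p r\<bar> < \<bar>s\<bar>" using K[OF that] s s0 by simp
    then have "(poly p r)\<^sup>2 < s\<^sup>2" using abs_le_square_iff[of s "poly p r"] by linarith
    then have "poly q r \<noteq> 0" by (simp add: q_def power2_eq_square)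
    moreover have "poly (map_poly of_real q) (complex_of_real r) = of_real (poly q r)"
      by (induction q) (simp_all add: map_poly_pCons)
    ultimately show ?thesis by simp
  qed
  from cop_poly_bounded_below[OF A this] obtain c where
    c: "c > 0" "\<And>x. c * norm x \<le> norm (cop_poly (map_poly of_real q) A x)" by blast
  have cq: "cop_poly (map_poly of_real q) A x = S (S x) - s\<^sup>2 *\<^sub>R x" for x
    unfolding cop_poly_of_real[OF BH]
    by (simp add: q_def op_poly_diff op_poly_mult S_def blinfun.bilinear_simps)
  \<comment> \<open>Expand the squared norm of \<open>S (S x) - s^2 x\<close>: symmetry turns the
    mixed term into \<open>-2 s^2\<close> times the squared norm of \<open>S x\<close>, and the norm
    of \<open>S (S x)\<close> is at most \<open>s^2 norm x\<close>. The lower bound \<open>c\<close>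
    then forces a fixed deficit below \<open>s^2\<close>.\<close>
  have bound: "(norm (S x))\<^sup>2 \<le> (s\<^sup>2 - c\<^sup>2 / (2 * s\<^sup>2)) * (norm x)\<^sup>2" for x
  proof -
    have "norm (S (S x)) \<le> s * norm (S x)" "norm (S x) \<le> s * norm x"
      unfolding s_def by (rule norm_blinfun)+
    then have "norm (S (S x)) \<le> s\<^sup>2 * norm x"
      by (metis mult.assoc mult_left_mono norm_ge_zero order_trans power2_eq_square s_def)
    then have 1: "(norm (S (S x)))\<^sup>2 \<le> (s\<^sup>2 * norm x)\<^sup>2"
      by (rule power_mono) simp
    have "(c * norm x)\<^sup>2 \<le> (norm (S (S x) - s\<^sup>2 *\<^sub>R x))\<^sup>2"
      using c(2)[of x] c(1) unfolding cq by (intro power_mono) auto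
    also have "\<dots> = (norm (S (S x)))\<^sup>2 - 2 * s\<^sup>2 * (norm (S x))\<^sup>2 + (s\<^sup>2 * norm x)\<^sup>2"
      using symmetric_opD[OF sym, of "S x" x]
      unfolding power2_norm_eq_inner power_mult_distrib
      by (simp add: inner_diff_left inner_diff_right inner_commute algebra_simps power2_eq_square)
    finally have "2 * s\<^sup>2 * (norm (S x))\<^sup>2 \<le> 2 * (s\<^sup>2 * norm x)\<^sup>2 - (c * norm x)\<^sup>2"
      using 1 by linarith
    then show ?thesis using s0 by (simp add: field_simps power2_eq_square)
  qed
  define d where "d = s\<^sup>2 - c\<^sup>2 / (2 * s\<^sup>2)"
  \<comment> \<open>Taking \<open>max 0 d\<close> keeps the square root meaningful without deciding
    the sign of \<open>d\<close>.\<close>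
  have "norm S \<le> sqrt (max 0 d)"
  proof (rule norm_blinfun_bound)
    fix x
    have "(norm (S x))\<^sup>2 \<le> (sqrt (max 0 d) * norm x)\<^sup>2"
      using bound[of x] mult_right_mono[of d "max 0 d" "(norm x)\<^sup>2"]
      by (simp add: power_mult_distrib d_def)
    then show "norm (S x) \<le> sqrt (max 0 d) * norm x"
      by (rule power2_le_imp_le) simp
  qed simp
  moreover have "sqrt (max 0 d) < s"
    using s0 c(1) by (intro real_less_lsqrt) (auto simp: d_def)
  ultimately show False by (simp add: s_def)
qed

section \<open>Continuous functional calculus\<close>

lemma poly_approximation:
  fixes g :: "real \<Rightarrow> real"
  assumes "compact S" "continuous_on S g" "0 < e"
  obtains p where "\<And>x. x \<in> S \<Longrightarrow> \<bar>g x - poly p x\<bar> < e"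
proof -
  obtain h where h: "real_polynomial_function h" "\<And>x. x \<in> S \<Longrightarrow> \<bar>g x - h x\<bar> < e"
    using Stone_Weierstrass_real_polynomial_function[OF assms] by blast
  then obtain a n where "h = (\<lambda>x. \<Sum>i\<le>n. a i * x ^ i)"
    by (auto simp: real_polynomial_function_iff_sum)
  then have "h x = poly (\<Sum>i\<le>n. monom (a i) i) x" for x
    by (simp add: poly_sum poly_monom)
  with h(2) show ?thesis using that by metis
qed

text \<open>The relation under the definite description in \<open>cfc\<close>. Its algebraic laws
  come before well-definedness, because uniqueness is itself deduced from the law for
  differences.\<close>

definition has_cfc :: "(real \<Rightarrow> real) \<Rightarrow> 'a::complex_hilbert_space op \<Rightarrow> 'a op \<Rightarrow> bool" where
  "has_cfc g A T \<longleftrightarrow> (\<exists>p. uniform_limit {0..norm A} (\<lambda>n. poly (p n)) g sequentially \<and>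
                       (\<lambda>n. op_poly (p n) A) \<longlonglongrightarrow> T)"

lemma cfc_eq_The: "cfc g A = (THE T. has_cfc g A T)"
  by (simp add: cfc_def has_cfc_def)

lemma has_cfc_poly: "has_cfc (poly p) A (op_poly p A)"
  unfolding has_cfc_def by (intro exI[of _ "\<lambda>_. p"] conjI uniform_limit_const tendsto_const)

lemma has_cfc_norm_le:
  fixes A :: "'a::complex_hilbert_space op"
  assumes A: "positive_op A" and T: "has_cfc g A T"
    and K: "\<And>x. x \<in> {0..norm A} \<Longrightarrow> \<bar>g x\<bar> \<le> K"
  shows "norm T \<le> K"
proof (rule field_le_epsilon)
  fix e :: real assume "0 < e"
  obtain p where p: "uniform_limit {0..norm A} (\<lambda>n. poly (p n)) g sequentially"
    "(\<lambda>n. op_poly (p n) A) \<longlonglongrightarrow> T" using T by (auto simp: has_cfc_def)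
  have "\<forall>\<^sub>F n in sequentially. norm (op_poly (p n) A) \<le> K + e"
    using uniform_limitD[OF p(1) \<open>0 < e\<close>]
  proof eventually_elim
    case (elim n)
    show ?case
    proof (rule norm_op_poly_le[OF A])
      fix r assume "r \<in> {0..norm A}"
      then show "\<bar>poly (p n) r\<bar> \<le> K + e"
        using elim K[of r] by (force simp: dist_real_def)
    qed
  qed
  then show "norm T \<le> K + e"
    using tendsto_norm[OF p(2)] tendsto_upperbound by fastforce
qed

lemma has_cfc_add: "has_cfc g A S \<Longrightarrow> has_cfc h A T \<Longrightarrow> has_cfc (\<lambda>x. g x + h x) A (S + T)"
  unfolding has_cfc_def
proof (elim exE conjE)
  fix p q
  assume "uniform_limit {0..norm A} (\<lambda>n. poly (p n)) g sequentially"
    "uniform_limit {0..norm A} (\<lambda>n. poly (q n)) h sequentially"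
    "(\<lambda>n. op_poly (p n) A) \<longlonglongrightarrow> S" "(\<lambda>n. op_poly (q n) A) \<longlonglongrightarrow> T"
  then show "\<exists>p. uniform_limit {0..norm A} (\<lambda>n. poly (p n)) (\<lambda>x. g x + h x) sequentially \<and>
      (\<lambda>n. op_poly (p n) A) \<longlonglongrightarrow> S + T"
    by (intro exI[of _ "\<lambda>n. p n + q n"])
      (auto simp: op_poly_add poly_add[abs_def] intro!: tendsto_add uniform_limit_add)
qed

lemma has_cfc_scaleR: "has_cfc g A S \<Longrightarrow> has_cfc (\<lambda>x. c * g x) A (c *\<^sub>R S)"
  unfolding has_cfc_def
proof (elim exE conjE)
  fix p
  assume "uniform_limit {0..norm A} (\<lambda>n. poly (p n)) g sequentially" "(\<lambda>n. op_poly (p n) A) \<longlonglongrightarrow> S"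
  then show "\<exists>p. uniform_limit {0..norm A} (\<lambda>n. poly (p n)) (\<lambda>x. c * g x) sequentially \<and>
      (\<lambda>n. op_poly (p n) A) \<longlonglongrightarrow> c *\<^sub>R S"
    by (intro exI[of _ "\<lambda>n. smult c (p n)"])
      (auto simp: op_poly_smult poly_smult[abs_def] intro!: tendsto_scaleR
        bounded_linear.uniform_limit[OF bounded_linear_mult_right])
qed

lemma has_cfc_diff: "has_cfc g A S \<Longrightarrow> has_cfc h A T \<Longrightarrow> has_cfc (\<lambda>x. g x - h x) A (S - T)"
  using has_cfc_add[of g A S "\<lambda>x. - 1 * h x" "- 1 *\<^sub>R T"] has_cfc_scaleR[of h A T "- 1"] by simp

lemma has_cfc_mult:
  assumes "has_cfc g A S" "has_cfc h A T"
    and "continuous_on {0..norm A} g" "continuous_on {0..norm A} h"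
  shows "has_cfc (\<lambda>x. g x * h x) A (S o\<^sub>L T)"
  using assms(1,2) unfolding has_cfc_def
proof (elim exE conjE)
  fix p q
  assume lim: "uniform_limit {0..norm A} (\<lambda>n. poly (p n)) g sequentially"
    "uniform_limit {0..norm A} (\<lambda>n. poly (q n)) h sequentially"
    "(\<lambda>n. op_poly (p n) A) \<longlonglongrightarrow> S" "(\<lambda>n. op_poly (q n) A) \<longlonglongrightarrow> T"
  \<comment> \<open>A product of uniform limits needs bounded limit functions; this is what
    continuity on the compact interval supplies.\<close>
  have "uniform_limit {0..norm A} (\<lambda>n x. poly (p n) x * poly (q n) x) (\<lambda>x. g x * h x) sequentially"
    by (intro uniform_lim_mult lim compact_imp_bounded compact_continuous_image assms compact_Icc)
  moreover have "(\<lambda>n. op_poly (p n) A o\<^sub>L op_poly (q n) A) \<longlonglongrightarrow> (S o\<^sub>L T)"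
    by (intro bounded_bilinear.tendsto[OF bounded_bilinear_blinfun_compose] lim)
  ultimately show "\<exists>p. uniform_limit {0..norm A} (\<lambda>n. poly (p n)) (\<lambda>x. g x * h x) sequentially \<and>
      (\<lambda>n. op_poly (p n) A) \<longlonglongrightarrow> (S o\<^sub>L T)"
    by (intro exI[of _ "\<lambda>n. p n * q n"]) (simp add: op_poly_mult poly_mult[abs_def])
qed

text \<open>The difference of two values is a value for the zero function, whose norm bound is
  \<open>0\<close>.\<close>

lemma has_cfc_unique:
  assumes "positive_op A" "has_cfc g A S" "has_cfc g A T"
  shows "S = T"
  using has_cfc_norm_le[OF assms(1) has_cfc_diff[OF assms(2,3)], of 0] by simp

text \<open>Choose Weierstrass polynomials with error below \<open>1/(n+1)\<close>. The bound on
  \<open>norm (p(A))\<close> turns their uniform closeness into a Cauchy sequence of operators, and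
  the operator space is complete.\<close>

lemma has_cfc_exists:
  fixes A :: "'a::complex_hilbert_space op"
  assumes A: "positive_op A" and g: "continuous_on {0..norm A} g"
  shows "\<exists>T. has_cfc g A T"
proof -
  have "\<exists>p. \<forall>x\<in>{0..norm A}. \<bar>g x - poly p x\<bar> < inverse (real (Suc n))" for n
    using poly_approximation[OF compact_Icc g, of "inverse (real (Suc n))"]
    by (metis of_nat_0_less_iff positive_imp_inverse_positive zero_less_Suc)
  then obtain p where p: "\<And>n x. x \<in> {0..norm A} \<Longrightarrow> \<bar>g x - poly (p n) x\<bar> < inverse (real (Suc n))"
    by metis
  have small: "\<exists>N. \<forall>n\<ge>N. inverse (real (Suc n)) < e" if e: "0 < e" for e :: real
  proof -
    obtain N where N: "inverse (real (Suc N)) < e" using reals_Archimedean[OF e] by blast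
    have "inverse (real (Suc n)) < e" if "n \<ge> N" for n
      using N le_imp_inverse_le[of "real (Suc N)" "real (Suc n)"] that by linarith
    then show ?thesis by blast
  qed
  have lim: "uniform_limit {0..norm A} (\<lambda>n. poly (p n)) g sequentially"
    unfolding uniform_limit_sequentially_iff
  proof (intro allI impI)
    fix e :: real assume "0 < e"
    then obtain N where "\<forall>n\<ge>N. inverse (real (Suc n)) < e" using small by blast
    then show "\<exists>N. \<forall>n\<ge>N. \<forall>x\<in>{0..norm A}. dist (poly (p n) x) (g x) < e"
      using p by (metis abs_minus_commute dist_real_def less_trans)
  qed
  have "Cauchy (\<lambda>n. op_poly (p n) A)"
  proof (rule CauchyI)
    fix e :: real assume "0 < e"
    then obtain N where N: "\<And>n. n \<ge> N \<Longrightarrow> inverse (real (Suc n)) < e / 4"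
      \<comment> \<open>Both approximations of \<open>g\<close> cost \<open>e / 4\<close>; the
        resulting non-strict bound \<open>e / 2\<close> leaves room for the strict one.\<close>
      using small[of "e / 4"] by auto
    have "norm (op_poly (p m) A - op_poly (p n) A) < e" if "m \<ge> N" "n \<ge> N" for m n
    proof -
      have "norm (op_poly (p m - p n) A) \<le> e / 2"
      proof (rule norm_op_poly_le[OF A])
        fix r assume r: "r \<in> {0..norm A}"
        show "\<bar>poly (p m - p n) r\<bar> \<le> e / 2"
          using p[OF r, of m] p[OF r, of n] N[OF that(1)] N[OF that(2)]
          unfolding poly_diff by linarith
      qed
      then show ?thesis using \<open>0 < e\<close> by (simp add: op_poly_diff)
    qed
    then show "\<exists>N. \<forall>m\<ge>N. \<forall>n\<ge>N. norm (op_poly (p m) A - op_poly (p n) A) < e" by blast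
  qed
  then obtain T where "(\<lambda>n. op_poly (p n) A) \<longlonglongrightarrow> T"
    by (auto simp: Cauchy_convergent_iff convergent_def)
  with lim show ?thesis unfolding has_cfc_def by blast
qed

section \<open>Algebra of the functional calculus\<close>

lemma cfc_eqI: "positive_op A \<Longrightarrow> has_cfc g A T \<Longrightarrow> cfc g A = T"
  unfolding cfc_eq_The by (blast intro: has_cfc_unique)

lemma has_cfc_cfc: "positive_op A \<Longrightarrow> continuous_on {0..norm A} g \<Longrightarrow> has_cfc g A (cfc g A)"
  using has_cfc_exists cfc_eqI by metis

lemma cfc_cong:
  assumes "\<And>x. x \<in> {0..norm A} \<Longrightarrow> g x = h x"
  shows "cfc g A = cfc h A"
proof -
  have "uniform_limit {0..norm A} F g sequentially \<longleftrightarrow> uniform_limit {0..norm A} F h sequentially" for F :: "nat \<Rightarrow> real \<Rightarrow> real"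
    by (rule uniform_limit_cong') (use assms in auto)
  then show ?thesis by (simp add: cfc_def)
qed

lemma cfc_poly: "positive_op A \<Longrightarrow> cfc (poly p) A = op_poly p A"
  by (intro cfc_eqI has_cfc_poly)

lemma cfc_const: "positive_op A \<Longrightarrow> cfc (\<lambda>_. c) A = c *\<^sub>R id_blinfun"
  using cfc_poly[of A "[:c:]"] by (simp add: poly_pCons[abs_def])

lemma cfc_ident: "positive_op A \<Longrightarrow> cfc (\<lambda>x. x) A = A"
  using cfc_poly[of A "[:0, 1:]"] by (simp add: poly_pCons[abs_def])

lemma cfc_add:
  assumes "positive_op A" "continuous_on {0..norm A} g" "continuous_on {0..norm A} h"
  shows "cfc (\<lambda>x. g x + h x) A = cfc g A + cfc h A"
  by (intro cfc_eqI has_cfc_add has_cfc_cfc assms)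

lemma cfc_diff:
  assumes "positive_op A" "continuous_on {0..norm A} g" "continuous_on {0..norm A} h"
  shows "cfc (\<lambda>x. g x - h x) A = cfc g A - cfc h A"
  by (intro cfc_eqI has_cfc_diff has_cfc_cfc assms)

lemma cfc_scaleR:
  assumes "positive_op A" "continuous_on {0..norm A} g"
  shows "cfc (\<lambda>x. c * g x) A = c *\<^sub>R cfc g A"
  by (intro cfc_eqI has_cfc_scaleR has_cfc_cfc assms)

lemma cfc_mult:
  assumes "positive_op A" "continuous_on {0..norm A} g" "continuous_on {0..norm A} h"
  shows "cfc (\<lambda>x. g x * h x) A = cfc g A o\<^sub>L cfc h A"
  by (intro cfc_eqI has_cfc_mult has_cfc_cfc assms)

lemma cfc_sum:
  assumes "positive_op A" "\<And>i. i \<in> I \<Longrightarrow> continuous_on {0..norm A} (g i)"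
  shows "cfc (\<lambda>x. \<Sum>i\<in>I. g i x) A = (\<Sum>i\<in>I. cfc (g i) A)"
  using assms(2)
  by (induction I rule: infinite_finite_induct)
    (simp_all add: cfc_const[OF assms(1)] cfc_add[OF assms(1)] continuous_on_sum)

lemma cfc_norm_le:
  assumes "positive_op A" "continuous_on {0..norm A} g"
    and "\<And>x. x \<in> {0..norm A} \<Longrightarrow> \<bar>g x\<bar> \<le> K"
  shows "norm (cfc g A) \<le> K"
  using has_cfc_norm_le[OF assms(1) has_cfc_cfc[OF assms(1,2)] assms(3)] .

lemma cfc_dist_le:
  assumes "positive_op A" "continuous_on {0..norm A} g" "continuous_on {0..norm A} h"
    and "\<And>x. x \<in> {0..norm A} \<Longrightarrow> \<bar>g x - h x\<bar> \<le> K"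
  shows "norm (cfc g A - cfc h A) \<le> K"
  unfolding cfc_diff[OF assms(1-3), symmetric]
  by (intro cfc_norm_le continuous_on_diff assms)

text \<open>The composition law with a polynomial outside, the only kind used to undo
  \<open>f\<close> on \<open>f(A)\<close>.\<close>

lemma op_poly_cfc:
  assumes A: "positive_op A" and g: "continuous_on {0..norm A} g"
  shows "op_poly q (cfc g A) = cfc (\<lambda>x. poly q (g x)) A"
proof (induction q)
  case (pCons a q)
  have "cfc (\<lambda>x. a + g x * poly q (g x)) A = a *\<^sub>R id_blinfun + (cfc g A o\<^sub>L cfc (\<lambda>x. poly q (g x)) A)"
    by (subst cfc_add[OF A]) (auto intro!: continuous_intros g cfc_mult[OF A g] simp: cfc_const[OF A])
  then show ?case by (simp add: pCons)
qed (simp add: cfc_const[OF A])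

lemma cfc_closure:
  assumes A: "positive_op A" and g: "continuous_on {0..norm A} g"
  obtains p where "(\<lambda>n. op_poly (p n) A) \<longlonglongrightarrow> cfc g A"
  using has_cfc_cfc[OF assms] unfolding has_cfc_def by blast

lemma cfc_BH:
  assumes A: "positive_op A" and g: "continuous_on {0..norm A} g"
  shows "cfc g A \<in> BH"
  using cfc_closure[OF assms] BH_closed op_poly_BH[OF positive_op_BH[OF A]] by metis

lemma cfc_symmetric:
  assumes A: "positive_op A" and g: "continuous_on {0..norm A} g"
  shows "symmetric_op (cfc g A)"
  using cfc_closure[OF assms] symmetric_op_closed op_poly_symmetric[OF positive_op_symmetric[OF A]]
  by metis

text \<open>The square root of \<open>g\<close> gives a symmetric operator whose square is
  \<open>g(A)\<close>, so the quadratic form is a squared norm.\<close>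

lemma cfc_positive:
  fixes A :: "'a::complex_hilbert_space op"
  assumes A: "positive_op A" and g: "continuous_on {0..norm A} g"
    and nonneg: "\<And>x. x \<in> {0..norm A} \<Longrightarrow> 0 \<le> g x"
  shows "positive_op (cfc g A)"
proof (rule positive_opI)
  fix x :: 'a
  have s: "continuous_on {0..norm A} (\<lambda>x. sqrt (g x))" by (intro continuous_intros g)
  have "cfc g A = cfc (\<lambda>x. sqrt (g x) * sqrt (g x)) A"
    by (rule cfc_cong) (simp add: nonneg)
  also have "\<dots> = cfc (\<lambda>x. sqrt (g x)) A o\<^sub>L cfc (\<lambda>x. sqrt (g x)) A"
    by (rule cfc_mult[OF A s s])
  finally have "inner x (blinfun_apply (cfc g A) x) =
      inner (blinfun_apply (cfc (\<lambda>x. sqrt (g x)) A) x) (blinfun_apply (cfc (\<lambda>x. sqrt (g x)) A) x)"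
    by (simp add: symmetric_opD[OF cfc_symmetric[OF A s]])
  then show "0 \<le> inner x (blinfun_apply (cfc g A) x)" by simp
qed (intro cfc_BH cfc_symmetric A g)+

section \<open>Inverses, and recovering an operator from a function of it\<close>

lemma is_inverse_op_unique: "is_inverse_op A B \<Longrightarrow> is_inverse_op A C \<Longrightarrow> B = C"
  unfolding is_inverse_op_def by (metis blinfun_compose_assoc blinfun_compose_id)

lemma inverse_op_eqI: "is_inverse_op A B \<Longrightarrow> inverse_op A = B"
  unfolding inverse_op_def using is_inverse_op_unique by blast

lemma is_inverse_op_cfc:
  assumes A: "positive_op A" and g: "continuous_on {0..norm A} g"
    and pos: "\<And>x. x \<in> {0..norm A} \<Longrightarrow> 0 < g x"
  shows "is_inverse_op (cfc g A) (cfc (\<lambda>x. inverse (g x)) A)"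
proof -
  have i: "continuous_on {0..norm A} (\<lambda>x. inverse (g x))"
    by (intro continuous_intros g) (use pos in force)
  have "cfc (\<lambda>x. g x * inverse (g x)) A = cfc (\<lambda>_. 1) A"
    "cfc (\<lambda>x. inverse (g x) * g x) A = cfc (\<lambda>_. 1) A"
    by (intro cfc_cong; use pos in force)+
  then show ?thesis
    by (simp add: is_inverse_op_def cfc_mult[OF A g i, symmetric] cfc_mult[OF A i g, symmetric]
        cfc_const[OF A])
qed

lemma inverse_op_cfc:
  assumes "positive_op A" "continuous_on {0..norm A} g" "\<And>x. x \<in> {0..norm A} \<Longrightarrow> 0 < g x"
  shows "inverse_op (cfc g A) = cfc (\<lambda>x. inverse (g x)) A"
  by (intro inverse_op_eqI is_inverse_op_cfc assms)

text \<open>Approximating the inverse function of \<open>f\<close> by polynomials \<open>q\<close> recovers both \<open>A\<close> and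
  \<open>B\<close> as the limit of \<open>q(f(A)) = q(f(B))\<close>.\<close>

lemma cfc_inject:
  fixes A B :: "'a::complex_hilbert_space op"
  assumes A: "positive_op A" and B: "positive_op B"
    and f: "continuous_on {0..} f" "inj_on f {0..}" and eq: "cfc f A = cfc f B"
  shows "A = B"
proof -
  define M where "M = max (norm A) (norm B)"
  have cont: "continuous_on {0..M} f" by (rule continuous_on_subset[OF f(1)]) auto
  define h where "h = the_inv_into {0..M} f"
  have h: "h (f x) = x" if "x \<in> {0..M}" for x
    unfolding h_def by (rule the_inv_into_f_f[OF inj_on_subset[OF f(2)] that]) auto
  \<comment> \<open>The inverse of a continuous injection on a compact set is continuous;
    \<open>M\<close> is chosen so that one interval serves both operators.\<close>
  have h_cont: "continuous_on (f ` {0..M}) h"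
    by (rule continuous_on_inv[OF cont compact_Icc]) (use h in blast)
  have compact: "compact (f ` {0..M})" by (rule compact_continuous_image[OF cont compact_Icc])
  have recover: "norm (op_poly q (cfc f C) - C) \<le> e"
    if C: "positive_op C" "norm C \<le> M" and q: "\<And>y. y \<in> f ` {0..M} \<Longrightarrow> \<bar>h y - poly q y\<bar> < e"
    for C :: "'a op" and q e
  proof -
    have fC: "continuous_on {0..norm C} f" by (rule continuous_on_subset[OF f(1)]) auto
    have "norm (cfc (\<lambda>x. poly q (f x)) C - cfc (\<lambda>x. x) C) \<le> e"
    proof (rule cfc_dist_le[OF C(1)])
      fix x assume "x \<in> {0..norm C}"
      then have "x \<in> {0..M}" using C(2) by simp
      then show "\<bar>poly q (f x) - x\<bar> \<le> e" using q[of "f x"] h[of x] by force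
    qed (auto intro!: continuous_intros fC)
    then show ?thesis by (simp add: op_poly_cfc[OF C(1) fC] cfc_ident[OF C(1)])
  qed
  have "norm (A - B) \<le> 0 + e" if e: "0 < e" for e
  proof -
    obtain q where "\<And>y. y \<in> f ` {0..M} \<Longrightarrow> \<bar>h y - poly q y\<bar> < e / 2"
      using poly_approximation[OF compact h_cont half_gt_zero[OF e]] by blast
    from recover[OF A _ this] recover[OF B _ this]
    have "norm (op_poly q (cfc f A) - A) \<le> e / 2" "norm (op_poly q (cfc f A) - B) \<le> e / 2"
      by (simp_all add: M_def eq)
    then show ?thesis
      using norm_triangle_ineq4[of "op_poly q (cfc f A) - B" "op_poly q (cfc f A) - A"] by simp
  qed
  then have "norm (A - B) \<le> 0" by (rule field_le_epsilon)
  then show ?thesis by simp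
qed

text \<open>On \<open>x I\<close> a polynomial acts as the scalar \<open>p(x)\<close>. The nonzero
  vector gives \<open>x \<le> norm (x I)\<close>, which places \<open>x\<close> in the interval
  where the polynomials converge to \<open>g\<close>.\<close>

lemma cfc_scaleR_id:
  fixes g :: "real \<Rightarrow> real"
  assumes nz: "\<exists>v::'a::complex_hilbert_space. v \<noteq> 0" and x: "0 \<le> x"
    and g: "continuous_on {0..} g"
  shows "cfc g (x *\<^sub>R id_blinfun :: 'a op) = g x *\<^sub>R id_blinfun"
proof -
  let ?X = "x *\<^sub>R id_blinfun :: 'a op"
  have X: "positive_op ?X" by (intro positive_op_scaleR x positive_op_id)
  obtain v :: 'a where "v \<noteq> 0" using nz by blast
  have "x * norm v \<le> norm ?X * norm v"
    using norm_blinfun[of ?X v] x by (simp add: blinfun.scaleR_left)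
  with \<open>v \<noteq> 0\<close> have "x \<le> norm ?X" by (simp only: mult_le_cancel_right) simp
  with x have mem: "x \<in> {0..norm ?X}" by simp
  have g': "continuous_on {0..norm ?X} g" by (rule continuous_on_subset[OF g]) auto
  obtain p where p: "uniform_limit {0..norm ?X} (\<lambda>n. poly (p n)) g sequentially"
    "(\<lambda>n. op_poly (p n) ?X) \<longlonglongrightarrow> cfc g ?X"
    using has_cfc_cfc[OF X g'] by (auto simp: has_cfc_def)
  have "(\<lambda>n. op_poly (p n) ?X) \<longlonglongrightarrow> g x *\<^sub>R id_blinfun"
    unfolding op_poly_scaleR_id by (intro tendsto_intros tendsto_uniform_limitI[OF p(1) mem])
  with p(2) show ?thesis using LIMSEQ_unique by blast
qed

section \<open>Harmonic means\<close>

text \<open>This is \<open>1 !_t x\<close> with denominators cleared. The case \<open>t = 0\<close>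
  is separate because \<open>x / x\<close> would be \<open>0\<close> at \<open>x = 0\<close>, where
  the value has to be \<open>1\<close>.\<close>

definition harmonic_kernel :: "real \<Rightarrow> real \<Rightarrow> real" where
  "harmonic_kernel t x = (if t = 0 then 1 else x / ((1 - t) * x + t))"

lemma harmonic_denominator_ge:
  fixes t x :: real
  assumes "t \<in> {0..1}" "0 \<le> x"
  shows "t \<le> (1 - t) * x + t"
  using assms by simp

lemma continuous_on_harmonic_kernel:
  assumes "t \<in> {0..1}"
  shows "continuous_on {0..} (harmonic_kernel t)"
proof (cases "t = 0")
  case False
  have "(1 - t) * x + t \<noteq> 0" if "0 \<le> x" for x
    using harmonic_denominator_ge[OF assms that] False assms by auto
  then have "continuous_on {0..} (\<lambda>x. x / ((1 - t) * x + t))"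
    by (auto intro!: continuous_intros)
  with False show ?thesis by (simp add: harmonic_kernel_def[abs_def])
qed (simp add: harmonic_kernel_def[abs_def])

text \<open>A bound free of \<open>t\<close>, which later dominates the integrands. After clearing
  the denominator the right side exceeds \<open>x\<close> by \<open>t + (1-t) x^2\<close>.\<close>

lemma harmonic_kernel_bound:
  assumes t: "t \<in> {0..1}" and x: "0 \<le> x"
  shows "\<bar>harmonic_kernel t x\<bar> \<le> 1 + x"
proof (cases "t = 0")
  case False
  have pos: "0 < (1 - t) * x + t" using harmonic_denominator_ge[OF t x] t False by auto
  have "x \<le> (1 + x) * ((1 - t) * x + t)"
    using t x mult_right_mono[of t 1 "x * x"] by (simp add: algebra_simps)
  with pos x show ?thesis
    using False by (simp add: harmonic_kernel_def divide_le_eq)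
qed (use x in \<open>simp add: harmonic_kernel_def\<close>)

text \<open>Cross-multiplication leaves \<open>t x < t y\<close>, so strictness comes exactly from
  \<open>t > 0\<close>.\<close>

lemma harmonic_kernel_strict_mono:
  assumes t: "t \<in> {0<..1}" and xy: "0 \<le> x" "x < y"
  shows "harmonic_kernel t x < harmonic_kernel t y"
proof -
  have pos: "0 < (1 - t) * x + t" "0 < (1 - t) * y + t"
    using t xy by (auto intro!: add_nonneg_pos)
  have "x * ((1 - t) * y + t) < y * ((1 - t) * x + t)"
    using t xy by (simp add: algebra_simps)
  with pos show ?thesis
    using t by (simp add: harmonic_kernel_def divide_less_eq less_divide_eq mult_ac)
qed

text \<open>A rate that is uniform in \<open>x\<close> for fixed \<open>t\<close>: the functional
  calculus then converts it into norm convergence of the regularised means.\<close>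

lemma harmonic_kernel_perturbation:
  assumes t: "t \<in> {0<..1}" and x: "x \<in> {0..M}" and e: "0 < e" "e \<le> 1"
  shows "\<bar>inverse ((1 - t) * inverse (1 + e) + t * inverse (x + e)) - harmonic_kernel t x\<bar>
    \<le> e * ((M + 2) / t + M / t\<^sup>2)"
proof -
  define w where "w = (1 - t) * x + t"
  have w: "t \<le> w" unfolding w_def using t x by simp
  have pos: "0 < t" "0 < w" "0 < w + e" "0 < x + e" "0 < 1 + e" using w t x e by auto
  \<comment> \<open>With \<open>w = (1-t) x + t\<close> the regularisation just replaces
    \<open>w\<close> by \<open>w + e\<close> in the denominator and multiplies out in the numerator.
    The two terms of the constant come from \<open>1 + x + e \<le> M + 2\<close> and from
    \<open>w \<ge> t\<close>.\<close>
  have "(1 - t) * inverse (1 + e) + t * inverse (x + e) = (w + e) / ((1 + e) * (x + e))"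
    using pos by (simp add: w_def field_simps)
  then have "inverse ((1 - t) * inverse (1 + e) + t * inverse (x + e)) - harmonic_kernel t x
      = (1 + e) * (x + e) / (w + e) - x / w"
    using t by (simp add: harmonic_kernel_def w_def)
  also have "(1 + e) * (x + e) = x + e * (1 + x + e)"
    by (simp add: algebra_simps)
  also have "(x + e * (1 + x + e)) / (w + e) - x / w
      = e * (1 + x + e) / (w + e) + (x / (w + e) - x / w)"
    by (simp add: add_divide_distrib)
  also have "x / (w + e) - x / w = - (e * x) / (w * (w + e))"
    using pos by (simp add: diff_frac_eq algebra_simps)
  also have "e * (1 + x + e) / (w + e) + - (e * x) / (w * (w + e))
      = e * ((1 + x + e) / (w + e) - x / (w * (w + e)))"
    by (simp add: right_diff_distrib)
  finally have eq: "inverse ((1 - t) * inverse (1 + e) + t * inverse (x + e)) - harmonic_kernel t x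
      = e * ((1 + x + e) / (w + e) - x / (w * (w + e)))" .
  have 1: "(1 + x + e) / (w + e) \<le> (M + 2) / t"
    using x e w pos by (intro frac_le) auto
  have "t\<^sup>2 \<le> w * (w + e)"
    using w pos e unfolding power2_eq_square by (intro mult_mono) auto
  then have 2: "x / (w * (w + e)) \<le> M / t\<^sup>2"
    using x pos by (intro frac_le) auto
  have "0 \<le> (1 + x + e) / (w + e)" "0 \<le> x / (w * (w + e))" using x pos by simp_all
  with 1 2 have "\<bar>(1 + x + e) / (w + e) - x / (w * (w + e))\<bar> \<le> (M + 2) / t + M / t\<^sup>2"
    by linarith
  then show ?thesis unfolding eq using e by (simp add: abs_mult)
qed

section \<open>The strong limits that define the harmonic mean\<close>

lemma harmonic_mean_eqI:
  assumes "strong_limit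
      (\<lambda>e. harmonic_strict t (A + e *\<^sub>R id_blinfun) (B + e *\<^sub>R id_blinfun)) L (at_right 0)"
  shows "harmonic_mean t A B = L"
  unfolding harmonic_mean_def
proof (rule the_equality)
  fix K
  assume "strong_limit
      (\<lambda>e. harmonic_strict t (A + e *\<^sub>R id_blinfun) (B + e *\<^sub>R id_blinfun)) K (at_right 0)"
  with assms show "K = L"
    unfolding strong_limit_def by (intro blinfun_eqI) (blast intro: tendsto_unique[OF trivial_limit_at_right_real])
qed (rule assms)

lemma strong_limit_of_tendsto:
  "((\<lambda>e. T e) \<longlongrightarrow> L) F \<Longrightarrow> strong_limit T L F"
  unfolding strong_limit_def by (intro allI blinfun.tendsto tendsto_const)

lemma cfc_add_scaleR_id:
  "positive_op A \<Longrightarrow> cfc (\<lambda>x. x + e) A = A + e *\<^sub>R id_blinfun"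
  by (subst cfc_add) (auto simp: cfc_ident cfc_const intro!: continuous_intros)

lemma inverse_op_inverse_op_shift:
  assumes A: "positive_op A" and e: "0 < e"
  shows "inverse_op (inverse_op (A + e *\<^sub>R id_blinfun)) = A + e *\<^sub>R id_blinfun"
proof -
  have cont: "continuous_on {0..norm A} (\<lambda>x. x + e)" by (intro continuous_intros)
  have "is_inverse_op (cfc (\<lambda>x. x + e) A) (cfc (\<lambda>x. inverse (x + e)) A)"
    by (rule is_inverse_op_cfc[OF A cont]) (use e in auto)
  then have inv: "is_inverse_op (A + e *\<^sub>R id_blinfun) (cfc (\<lambda>x. inverse (x + e)) A)"
    by (simp only: cfc_add_scaleR_id[OF A])
  then have "is_inverse_op (cfc (\<lambda>x. inverse (x + e)) A) (A + e *\<^sub>R id_blinfun)"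
    by (simp add: is_inverse_op_def)
  with inv show ?thesis by (simp add: inverse_op_eqI)
qed

text \<open>At \<open>t = 0\<close> the regularised mean is the double inverse of
  \<open>A + e I\<close>, that is \<open>A + e I\<close> itself.\<close>

lemma harmonic_mean_0:
  assumes A: "positive_op A"
  shows "harmonic_mean 0 A B = A"
proof (intro harmonic_mean_eqI strong_limit_of_tendsto)
  have "((\<lambda>e. A + e *\<^sub>R id_blinfun) \<longlongrightarrow> A + 0 *\<^sub>R id_blinfun) (at_right 0)"
    by (intro tendsto_intros)
  moreover have "\<forall>\<^sub>F e in at_right 0.
      A + e *\<^sub>R id_blinfun = harmonic_strict 0 (A + e *\<^sub>R id_blinfun) (B + e *\<^sub>R id_blinfun)"
    using eventually_at_right_less
    by eventually_elim (simp add: harmonic_strict_def inverse_op_inverse_op_shift[OF A])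
  ultimately show "((\<lambda>e. harmonic_strict 0 (A + e *\<^sub>R id_blinfun) (B + e *\<^sub>R id_blinfun)) \<longlongrightarrow> A) (at_right 0)"
    using Lim_transform_eventually by fastforce
qed

text \<open>Both regularised arguments are functions of \<open>A\<close>, so sums and inverses can
  be formed on scalars.\<close>

lemma harmonic_strict_id:
  assumes A: "positive_op A" and t: "t \<in> {0..1}" and e: "0 < e"
  shows "harmonic_strict t (id_blinfun + e *\<^sub>R id_blinfun) (A + e *\<^sub>R id_blinfun)
    = cfc (\<lambda>x. inverse ((1 - t) * inverse (1 + e) + t * inverse (x + e))) A"
proof -
  have cont: "continuous_on {0..norm A} (\<lambda>x. inverse (x + e))"
    by (intro continuous_intros) (use e in auto)
  have id: "id_blinfun + e *\<^sub>R id_blinfun = cfc (\<lambda>_. 1 + e) A"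
    by (simp add: cfc_const[OF A] scaleR_left_distrib)
  have "inverse_op (id_blinfun + e *\<^sub>R id_blinfun) = cfc (\<lambda>_. inverse (1 + e)) A"
    unfolding id by (rule inverse_op_cfc[OF A]) (use e in auto)
  moreover have "inverse_op (A + e *\<^sub>R id_blinfun) = cfc (\<lambda>x. inverse (x + e)) A"
    unfolding cfc_add_scaleR_id[OF A, symmetric]
    by (rule inverse_op_cfc[OF A]) (use e in \<open>auto intro!: continuous_intros\<close>)
  ultimately have sum: "(1 - t) *\<^sub>R inverse_op (id_blinfun + e *\<^sub>R id_blinfun)
        + t *\<^sub>R inverse_op (A + e *\<^sub>R id_blinfun)
      = cfc (\<lambda>x. (1 - t) * inverse (1 + e) + t * inverse (x + e)) A"
    by (subst cfc_add[OF A])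
      (auto simp: cfc_scaleR[OF A cont] cfc_const[OF A] intro!: continuous_intros cont)
  have pos: "0 < (1 - t) * inverse (1 + e) + t * inverse (x + e)" if "x \<in> {0..norm A}" for x
    using t e that by (cases "t = 0") (auto intro!: add_nonneg_pos)
  show ?thesis
    unfolding harmonic_strict_def sum
    by (rule inverse_op_cfc[OF A]) (auto intro!: continuous_intros cont pos)
qed

text \<open>For \<open>t > 0\<close> the convergence holds even in norm, at rate
  \<open>e * K\<close>. Since \<open>K\<close> divides by \<open>t\<close>, the endpoint
  \<open>t = 0\<close> is treated apart.\<close>

lemma harmonic_mean_id:
  assumes A: "positive_op A" and t: "t \<in> {0..1}"
  shows "harmonic_mean t id_blinfun A = cfc (harmonic_kernel t) A"
proof (cases "t = 0")
  case True
  then show ?thesis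
    by (simp add: harmonic_mean_0 harmonic_kernel_def[abs_def] cfc_const[OF A])
next
  case False
  with t have t': "t \<in> {0<..1}" by auto
  define K where "K = (norm A + 2) / t + norm A / t\<^sup>2"
  have kernel: "continuous_on {0..norm A} (harmonic_kernel t)"
    by (rule continuous_on_subset[OF continuous_on_harmonic_kernel[OF t]]) auto
  show ?thesis
  proof (intro harmonic_mean_eqI strong_limit_of_tendsto)
    let ?H = "\<lambda>e. harmonic_strict t (id_blinfun + e *\<^sub>R id_blinfun) (A + e *\<^sub>R id_blinfun)"
    have "norm (?H e - cfc (harmonic_kernel t) A) \<le> e * K" if e: "0 < e" "e < 1" for e
      unfolding harmonic_strict_id[OF A t e(1)]
    proof (rule cfc_dist_le[OF A _ kernel])
      have "(1 - t) * inverse (1 + e) + t * inverse (x + e) \<noteq> 0" if "0 \<le> x" for x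
      proof -
        have "0 \<le> (1 - t) * inverse (1 + e)" "0 < t * inverse (x + e)" using t' e that by auto
        then show ?thesis by linarith
      qed
      then show "continuous_on {0..norm A} (\<lambda>x. inverse ((1 - t) * inverse (1 + e) + t * inverse (x + e)))"
        by (auto intro!: continuous_intros) (use e in auto)
    next
      fix x assume "x \<in> {0..norm A}"
      then show "\<bar>inverse ((1 - t) * inverse (1 + e) + t * inverse (x + e)) - harmonic_kernel t x\<bar> \<le> e * K"
        using harmonic_kernel_perturbation[OF t', of x "norm A" e] e by (simp add: K_def)
    qed
    moreover have "\<forall>\<^sub>F e in at_right 0. 0 < e \<and> e < (1::real)"
      by (auto intro: eventually_at_rightI[of 0 1])
    ultimately have "\<forall>\<^sub>F e in at_right 0. norm (?H e - cfc (harmonic_kernel t) A) \<le> e * K"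
      by (auto elim: eventually_mono)
    moreover have "((\<lambda>e. e * K) \<longlongrightarrow> 0) (at_right 0)"
      by (intro tendsto_mult_left_zero tendsto_ident_at)
    ultimately have "((\<lambda>e. ?H e - cfc (harmonic_kernel t) A) \<longlongrightarrow> 0) (at_right 0)"
      by (rule Lim_null_comparison)
    then show "(?H \<longlongrightarrow> cfc (harmonic_kernel t) A) (at_right 0)"
      by (rule LIM_zero_cancel)
  qed
qed

section \<open>The connection in terms of its representing function\<close>

text \<open>\<open>g \<mapsto> \<langle>u, g(A) v\<rangle>\<close> need not be known as an integral: replacing \<open>g\<close> by its
  Bernstein polynomials turns it into a finite sum of point evaluations of \<open>g\<close>, which
  commutes with integration over a parameter of \<open>g\<close>.\<close>

definition bernstein_form ::
    "'a::complex_hilbert_space op \<Rightarrow> 'a \<Rightarrow> 'a \<Rightarrow> nat \<Rightarrow> (real \<Rightarrow> real) \<Rightarrow> real" where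
  "bernstein_form A u v n g = (\<Sum>k\<le>n. g (norm A * (k / n)) *
     inner u (blinfun_apply (cfc (\<lambda>x. Bernstein n k (x / norm A)) A) v))"

lemma bernstein_node:
  assumes "k \<le> n"
  shows "norm A * (real k / real n) \<in> {0..norm A}"
proof -
  \<comment> \<open>This includes \<open>n = 0\<close>, where the quotient is \<open>0\<close> by
    convention.\<close>
  have "0 \<le> real k / real n" "real k / real n \<le> 1" using assms by (auto simp: divide_le_eq_1)
  then show ?thesis
    using mult_left_mono[of "real k / real n" 1 "norm A"] by simp
qed

lemma bernstein_scaled_mem: "x \<in> {0..norm A} \<Longrightarrow> x / norm A \<in> {0..1}"
  by (auto simp: divide_le_eq_1)

lemma bernstein_form_eq_cfc:
  fixes A :: "'a::complex_hilbert_space op"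
  assumes A: "positive_op A"
  shows "bernstein_form A u v n g =
    inner u (blinfun_apply (cfc (\<lambda>x. \<Sum>k\<le>n. g (norm A * (k / n)) * Bernstein n k (x / norm A)) A) v)"
proof -
  have cont: "continuous_on {0..norm A} (\<lambda>x. Bernstein n k (x / norm A))" for k
    unfolding Bernstein_def by (cases "norm A = 0") (auto intro!: continuous_intros)
  show ?thesis
    unfolding bernstein_form_def
    by (subst cfc_sum[OF A])
      (auto intro!: continuous_on_mult_left cont
        simp: cfc_scaleR[OF A cont] blinfun.sum_left blinfun.scaleR_left inner_sum_right)
qed

lemma continuous_on_bernstein_sum:
  "continuous_on {0..norm (A :: 'a::real_normed_vector)} (\<lambda>x. \<Sum>k\<le>n. c k * Bernstein n k (x / norm A))"
  unfolding Bernstein_def by (cases "norm A = 0") (auto intro!: continuous_intros)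

lemma inner_blinfun_le:
  assumes "norm T \<le> K"
  shows "\<bar>inner u (blinfun_apply T v)\<bar> \<le> norm u * (K * norm v)"
proof -
  have "norm (blinfun_apply T v) \<le> K * norm v"
    using norm_blinfun[of T v] mult_right_mono[OF assms norm_ge_zero[of v]] by linarith
  then have "norm u * norm (blinfun_apply T v) \<le> norm u * (K * norm v)"
    by (rule mult_left_mono) simp
  then show ?thesis using Cauchy_Schwarz_ineq2[of u "blinfun_apply T v"] by linarith
qed

text \<open>Bernstein polynomials are nonnegative and sum to \<open>1\<close>, so the approximants
  obey the same bound \<open>K\<close> as \<open>g\<close>, uniformly in \<open>n\<close>. This is
  what dominated convergence requires.\<close>

lemma bernstein_form_bound:
  fixes A :: "'a::complex_hilbert_space op"
  assumes A: "positive_op A" and g: "\<And>x. x \<in> {0..norm A} \<Longrightarrow> \<bar>g x\<bar> \<le> K"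
  shows "\<bar>bernstein_form A u v n g\<bar> \<le> norm u * (K * norm v)"
  unfolding bernstein_form_eq_cfc[OF A]
proof (intro inner_blinfun_le cfc_norm_le[OF A] continuous_on_bernstein_sum)
  fix x assume "x \<in> {0..norm A}"
  then have x: "x / norm A \<in> {0..1}" by (rule bernstein_scaled_mem)
  have "\<bar>\<Sum>k\<le>n. g (norm A * (k / n)) * Bernstein n k (x / norm A)\<bar>
      \<le> (\<Sum>k\<le>n. \<bar>g (norm A * (k / n)) * Bernstein n k (x / norm A)\<bar>)"
    by (rule sum_abs)
  also have "\<dots> \<le> (\<Sum>k\<le>n. K * Bernstein n k (x / norm A))"
  proof (rule sum_mono)
    fix k assume "k \<in> {..n}"
    then have "\<bar>g (norm A * (k / n))\<bar> \<le> K" by (intro g bernstein_node) simp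
    then show "\<bar>g (norm A * (k / n)) * Bernstein n k (x / norm A)\<bar> \<le> K * Bernstein n k (x / norm A)"
      unfolding abs_mult using x by (intro mult_mono) (auto simp: Bernstein_nonneg)
  qed
  also have "\<dots> = K" by (simp flip: sum_distrib_left)
  finally show "\<bar>\<Sum>k\<le>n. g (norm A * (k / n)) * Bernstein n k (x / norm A)\<bar> \<le> K" .
qed

lemma bernstein_form_tendsto:
  fixes A :: "'a::complex_hilbert_space op"
  assumes A: "positive_op A" and g: "continuous_on {0..norm A} g"
  shows "(\<lambda>n. bernstein_form A u v n g) \<longlonglongrightarrow> inner u (blinfun_apply (cfc g A) v)"
proof -
  let ?B = "\<lambda>n x. \<Sum>k\<le>n. g (norm A * (k / n)) * Bernstein n k (x / norm A)"
  have "(\<lambda>n. cfc (?B n) A) \<longlonglongrightarrow> cfc g A"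
  proof (rule LIMSEQ_I)
    fix e :: real assume "0 < e"
    have "continuous_on {0..1} (\<lambda>s. g (norm A * s))"
      by (intro continuous_on_compose2[OF g] continuous_intros)
        (auto simp: mult.commute[of "norm A"] mult_left_le_one_le)
    from Bernstein_Weierstrass[OF this half_gt_zero[OF \<open>0 < e\<close>]]
    obtain N where N: "\<And>n x. N \<le> n \<Longrightarrow> x \<in> {0..1} \<Longrightarrow>
        \<bar>g (norm A * x) - (\<Sum>k\<le>n. g (norm A * (k / n)) * Bernstein n k x)\<bar> < e / 2"
      by blast
    have "norm (cfc (?B n) A - cfc g A) < e" if "N \<le> n" for n
    proof -
      have "norm (cfc (?B n) A - cfc g A) \<le> e / 2"
      proof (rule cfc_dist_le[OF A continuous_on_bernstein_sum g])
        fix x assume x: "x \<in> {0..norm A}"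
        \<comment> \<open>If \<open>norm A = 0\<close>, then \<open>x = 0\<close> and the division
          by zero yields \<open>0\<close>, so the rescaling remains correct.\<close>
        then have "norm A * (x / norm A) = x" by auto
        then show "\<bar>?B n x - g x\<bar> \<le> e / 2"
          using N[OF that bernstein_scaled_mem[OF x]] abs_minus_commute[of "g x" "?B n x"] by simp
      qed
      with \<open>0 < e\<close> show ?thesis by simp
    qed
    then show "\<exists>N. \<forall>n\<ge>N. norm (cfc (?B n) A - cfc g A) < e" by blast
  qed
  then show ?thesis
    unfolding bernstein_form_eq_cfc[OF A] by (intro tendsto_intros)
qed

section \<open>Integral formulas for \<open>f\<close> and for \<open>\<sigma> I A\<close>\<close>

lemma associated_measure_space:
  assumes "associated_measure \<sigma> \<mu>"
  shows "space \<mu> = {0..1}"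
proof -
  have "sets \<mu> = sets unit_borel" using assms by (simp add: associated_measure_def)
  then have "space \<mu> = space unit_borel" by (rule sets_eq_imp_space_eq)
  then show ?thesis by (simp add: space_restrict_space)
qed

lemma associated_measure_inner:
  assumes "associated_measure \<sigma> \<mu>" "positive_op A" "positive_op B"
  shows "has_bochner_integral \<mu> (\<lambda>t. inner u (blinfun_apply (harmonic_mean t A B) v))
    (inner u (blinfun_apply (\<sigma> A B) v))"
proof -
  have "has_bochner_integral \<mu> (\<lambda>t. cinner u (blinfun_apply (harmonic_mean t A B) v))
    (cinner u (blinfun_apply (\<sigma> A B) v))"
    using assms by (simp add: associated_measure_def has_weak_integral_def)
  from has_bochner_integral_bounded_linear[OF bounded_linear_Re this]
  show ?thesis by (simp add: Re_cinner)
qed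

text \<open>Test the weak integral of \<open>\<sigma> I (x I)\<close> on a nonzero vector
  \<open>v\<close>: both sides are scalars times \<open>inner v v\<close>, which cancels.\<close>

lemma representing_function_integral:
  fixes \<sigma> :: "'a::complex_hilbert_space op \<Rightarrow> 'a op \<Rightarrow> 'a op"
  assumes nz: "\<exists>v::'a. v \<noteq> 0" and f: "representing_function \<sigma> f"
    and \<mu>: "associated_measure \<sigma> \<mu>" and x: "0 \<le> x"
  shows "has_bochner_integral \<mu> (\<lambda>t. harmonic_kernel t x) (f x)"
proof -
  obtain v :: 'a where v: "v \<noteq> 0" using nz by blast
  have X: "positive_op (x *\<^sub>R id_blinfun :: 'a op)" by (intro positive_op_scaleR x positive_op_id)
  have "\<sigma> id_blinfun (x *\<^sub>R id_blinfun) = f x *\<^sub>R id_blinfun"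
    using f x by (simp add: representing_function_def)
  with associated_measure_inner[OF \<mu> positive_op_id X, of v v]
  have "has_bochner_integral \<mu> (\<lambda>t. inner v (blinfun_apply (harmonic_mean t id_blinfun (x *\<^sub>R id_blinfun)) v))
    (f x * inner v v)"
    by (simp add: blinfun.scaleR_left)
  moreover have "inner v (blinfun_apply (harmonic_mean t id_blinfun (x *\<^sub>R id_blinfun)) v)
      = harmonic_kernel t x * inner v v" if "t \<in> space \<mu>" for t
  proof -
    have t: "t \<in> {0..1}" using that associated_measure_space[OF \<mu>] by simp
    show ?thesis
      by (simp add: harmonic_mean_id[OF X t] blinfun.scaleR_left
          cfc_scaleR_id[OF nz x continuous_on_harmonic_kernel[OF t]])
  qed
  ultimately have "has_bochner_integral \<mu> (\<lambda>t. harmonic_kernel t x * inner v v) (f x * inner v v)"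
    by (subst has_bochner_integral_cong[OF refl _ refl, symmetric])
  from has_bochner_integral_mult_left[OF this, of "inverse (inner v v)"] v
  show ?thesis by (simp only: mult.assoc inner_eq_zero_iff right_inverse mult_1_right simp_thms)
qed

text \<open>For fixed \<open>n\<close> the Bernstein form sees its function only at finitely many
  points, where \<open>f\<close> is the integral of the kernels. Letting \<open>n\<close> grow
  inside and outside the integral gives the two sides of the equation.\<close>

lemma connection_id_eq_cfc:
  fixes \<sigma> :: "'a::complex_hilbert_space op \<Rightarrow> 'a op \<Rightarrow> 'a op"
  assumes nz: "\<exists>v::'a. v \<noteq> 0" and f: "representing_function \<sigma> f"
    and \<mu>: "associated_measure \<sigma> \<mu>" and A: "positive_op A"
  shows "\<sigma> id_blinfun A = cfc f A"
proof (rule blinfun_eqI)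
  fix v
  have f_cont: "continuous_on {0..norm A} f"
    by (rule continuous_on_subset[of "{0..}"])
      (use f in \<open>auto simp: representing_function_def operator_monotone_def\<close>)
  interpret finite_measure \<mu> using \<mu> by (simp add: associated_measure_def)
  have "inner u (blinfun_apply (\<sigma> id_blinfun A) v) = inner u (blinfun_apply (cfc f A) v)" for u
  proof -
    have kernel: "continuous_on {0..norm A} (harmonic_kernel t)" if "t \<in> {0..1}" for t
      by (rule continuous_on_subset[OF continuous_on_harmonic_kernel[OF that]]) auto
    have form: "has_bochner_integral \<mu> (\<lambda>t. bernstein_form A u v n (harmonic_kernel t))
        (bernstein_form A u v n f)" for n
      unfolding bernstein_form_def
      by (intro has_bochner_integral_sum has_bochner_integral_mult_left
          representing_function_integral[OF nz f \<mu>]) simp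
    have limit: "has_bochner_integral \<mu> (\<lambda>t. inner u (blinfun_apply (cfc (harmonic_kernel t) A) v))
        (inner u (blinfun_apply (\<sigma> id_blinfun A) v))"
      using associated_measure_inner[OF \<mu> positive_op_id A, of u v]
      by (subst has_bochner_integral_cong[OF refl _ refl])
        (simp_all add: harmonic_mean_id[OF A] associated_measure_space[OF \<mu>])
    have "(\<lambda>n. \<integral>t. bernstein_form A u v n (harmonic_kernel t) \<partial>\<mu>)
        \<longlonglongrightarrow> (\<integral>t. inner u (blinfun_apply (cfc (harmonic_kernel t) A) v) \<partial>\<mu>)"
    \<comment> \<open>Measurability of the approximants and of the limit is read off from the
      integrals \<open>form\<close> and \<open>limit\<close>; the dominating constant is integrable
      since the measure is finite.\<close>
    proof (rule integral_dominated_convergence)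
      show "AE t in \<mu>. (\<lambda>n. bernstein_form A u v n (harmonic_kernel t))
          \<longlonglongrightarrow> inner u (blinfun_apply (cfc (harmonic_kernel t) A) v)"
        by (rule AE_I2) (use bernstein_form_tendsto[OF A kernel] associated_measure_space[OF \<mu>] in auto)
      show "AE t in \<mu>. norm (bernstein_form A u v n (harmonic_kernel t))
          \<le> norm u * ((1 + norm A) * norm v)" for n
      proof (rule AE_I2)
        fix t assume "t \<in> space \<mu>"
        then have t: "t \<in> {0..1}" using associated_measure_space[OF \<mu>] by simp
        have "\<bar>harmonic_kernel t x\<bar> \<le> 1 + norm A" if "x \<in> {0..norm A}" for x
          using harmonic_kernel_bound[OF t, of x] that by auto
        then show "norm (bernstein_form A u v n (harmonic_kernel t)) \<le> norm u * ((1 + norm A) * norm v)"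
          using bernstein_form_bound[OF A] by simp
      qed
    qed (use form limit in \<open>auto dest: integrable.intros intro: borel_measurable_integrable\<close>)
    then have "(\<lambda>n. bernstein_form A u v n f) \<longlonglongrightarrow> inner u (blinfun_apply (\<sigma> id_blinfun A) v)"
      by (simp add: has_bochner_integral_integral_eq[OF form] has_bochner_integral_integral_eq[OF limit])
    with bernstein_form_tendsto[OF A f_cont] show ?thesis
      using LIMSEQ_unique by blast
  qed
  then show "blinfun_apply (\<sigma> id_blinfun A) v = blinfun_apply (cfc f A) v"
    using vector_eq_ldot by blast
qed

section \<open>Cancellability\<close>

lemma positive_op_conjugate:
  assumes A: "positive_op A" and C: "positive_op C"
  shows "positive_op (C o\<^sub>L A o\<^sub>L C)"
proof (rule positive_opI)
  show "C o\<^sub>L A o\<^sub>L C \<in> BH" by (intro BH_compose positive_op_BH A C)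
  note sym = symmetric_opD[OF positive_op_symmetric[OF A]] symmetric_opD[OF positive_op_symmetric[OF C]]
  show "symmetric_op (C o\<^sub>L A o\<^sub>L C)" by (simp add: symmetric_op_def sym)
  fix x
  show "0 \<le> inner x (blinfun_apply (C o\<^sub>L A o\<^sub>L C) x)"
    using positive_op_inner_nonneg[OF A, of "blinfun_apply C x"] by (simp add: sym)
qed

text \<open>The quadratic form of \<open>T = B - A\<close> is zero. Evaluating it at
  \<open>x + T x\<close> and using symmetry leaves twice the squared norm of
  \<open>T x\<close>.\<close>

lemma op_le_antisym:
  assumes "A \<preceq> B" "B \<preceq> A"
  shows "A = B"
proof -
  have sym: "symmetric_op (B - A)" and BA: "\<And>x. 0 \<le> inner x (blinfun_apply (B - A) x)"
    and AB: "\<And>x. 0 \<le> inner x (blinfun_apply (A - B) x)"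
    using assms by (auto simp: op_le_def positive_op_iff)
  have zero: "inner x (blinfun_apply (B - A) x) = 0" for x
    using BA[of x] AB[of x] by (simp add: blinfun.diff_left inner_diff_right)
  have "blinfun_apply (B - A) x = 0" for x
  proof -
    let ?y = "blinfun_apply (B - A) x"
    have "inner (x + ?y) (blinfun_apply (B - A) (x + ?y)) = 0" by (rule zero)
    then have "inner x (blinfun_apply (B - A) ?y) + inner ?y ?y = 0"
      using zero[of x] zero[of ?y] unfolding blinfun.add_right inner_add_left inner_add_right
      by linarith
    then have "inner ?y ?y = 0"
      by (simp add: symmetric_opD[OF sym, symmetric])
    then show ?thesis by simp
  qed
  then show ?thesis by (intro blinfun_eqI) (simp add: blinfun.diff_left)
qed

text \<open>With \<open>x = A (B x)\<close>, the form of \<open>B\<close> at \<open>x\<close>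
  becomes the form of \<open>A\<close> at \<open>B x\<close>.\<close>

lemma positive_op_inverse:
  assumes A: "positive_op A" and B: "B \<in> BH" "is_inverse_op A B"
  shows "positive_op B"
proof (rule positive_opI[OF B(1)])
  have AB: "blinfun_apply A (blinfun_apply B x) = x" for x
    using B(2) by (metis is_inverse_op_def blinfun_apply_blinfun_compose blinfun_apply_id_blinfun)
  note sym = symmetric_opD[OF positive_op_symmetric[OF A]]
  show "symmetric_op B"
    unfolding symmetric_op_def using AB sym by metis
  fix x
  show "0 \<le> inner x (blinfun_apply B x)"
    using positive_op_inner_nonneg[OF A, of "blinfun_apply B x"] AB[of x] by (simp add: inner_commute)
qed

text \<open>The inverse root cannot be taken as a function of \<open>A\<close>, because the interval
  of the calculus contains \<open>0\<close>. Instead the inverse \<open>B\<close> of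
  \<open>S S\<close> gives \<open>S\<close> a right inverse \<open>S B\<close> and a left inverse
  \<open>B S\<close>, which must agree.\<close>

lemma strictly_positive_op_sqrt:
  fixes A :: "'a::complex_hilbert_space op"
  assumes "strictly_positive_op A"
  obtains S R where "positive_op S" "positive_op R" "is_inverse_op S R" "S o\<^sub>L S = A"
proof -
  from assms obtain B where A: "positive_op A" and B: "B \<in> BH" "is_inverse_op A B"
    by (auto simp: strictly_positive_op_def)
  have cont: "continuous_on {0..norm A} sqrt" by (intro continuous_intros)
  define S where "S = cfc sqrt A"
  have S: "positive_op S" unfolding S_def by (rule cfc_positive[OF A cont]) simp
  have "cfc (\<lambda>x. sqrt x * sqrt x) A = cfc (\<lambda>x. x) A" by (rule cfc_cong) simp
  then have SS: "S o\<^sub>L S = A"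
    unfolding S_def cfc_mult[OF A cont cont] cfc_ident[OF A] .
  have right: "S o\<^sub>L (S o\<^sub>L B) = id_blinfun" and left: "(B o\<^sub>L S) o\<^sub>L S = id_blinfun"
    using B(2) by (simp_all add: is_inverse_op_def blinfun_compose_assoc SS)
      (metis SS blinfun_compose_assoc)
  have "S o\<^sub>L B = B o\<^sub>L S"
    using left right by (metis blinfun_compose_assoc blinfun_compose_id)
  then have inv: "is_inverse_op S (S o\<^sub>L B)"
    using left right by (simp add: is_inverse_op_def)
  moreover have "positive_op (S o\<^sub>L B)"
    by (rule positive_op_inverse[OF S _ inv]) (intro BH_compose positive_op_BH S B)
  ultimately show ?thesis using that S SS by blast
qed

text \<open>One inequality is (M2) for \<open>S\<close>. The other is (M2) for \<open>R\<close> at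
  the conjugated pair, conjugated back by \<open>S\<close>, which preserves the order.\<close>

lemma connection_congruence:
  fixes \<sigma> :: "'a::complex_hilbert_space op \<Rightarrow> 'a op \<Rightarrow> 'a op"
  assumes \<sigma>: "connection \<sigma>" and A: "positive_op A" and B: "positive_op B"
    and S: "positive_op S" and R: "positive_op R" and inv: "is_inverse_op S R"
  shows "S o\<^sub>L \<sigma> A B o\<^sub>L S = \<sigma> (S o\<^sub>L A o\<^sub>L S) (S o\<^sub>L B o\<^sub>L S)"
proof (rule op_le_antisym)
  have trans: "C o\<^sub>L \<sigma> A B o\<^sub>L C \<preceq> \<sigma> (C o\<^sub>L A o\<^sub>L C) (C o\<^sub>L B o\<^sub>L C)"
    if "positive_op A" "positive_op B" "positive_op C" for A B C
    using \<sigma> that unfolding connection_def by blast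
  show "S o\<^sub>L \<sigma> A B o\<^sub>L S \<preceq> \<sigma> (S o\<^sub>L A o\<^sub>L S) (S o\<^sub>L B o\<^sub>L S)"
    by (rule trans[OF A B S])
  have conj: "R o\<^sub>L (S o\<^sub>L X o\<^sub>L S) o\<^sub>L R = X" "S o\<^sub>L (R o\<^sub>L X o\<^sub>L R) o\<^sub>L S = X" for X
    using inv unfolding is_inverse_op_def by (metis blinfun_compose_assoc blinfun_compose_id)+
  let ?Y = "\<sigma> (S o\<^sub>L A o\<^sub>L S) (S o\<^sub>L B o\<^sub>L S)"
  have "R o\<^sub>L ?Y o\<^sub>L R \<preceq> \<sigma> A B"
    using trans[OF positive_op_conjugate[OF A S] positive_op_conjugate[OF B S] R] by (simp only: conj)
  then have "positive_op (S o\<^sub>L (\<sigma> A B - (R o\<^sub>L ?Y o\<^sub>L R)) o\<^sub>L S)"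
    unfolding op_le_def by (rule positive_op_conjugate[OF _ S])
  then show "?Y \<preceq> S o\<^sub>L \<sigma> A B o\<^sub>L S"
    by (simp only: op_le_def blinfun_compose_simps conj)
qed

lemma left_cancellable_connection_iff:
  fixes \<sigma> :: "'a::complex_hilbert_space op \<Rightarrow> 'a op \<Rightarrow> 'a op"
  assumes \<sigma>: "connection \<sigma>"
  shows "left_cancellable_connection \<sigma> \<longleftrightarrow>
    (\<forall>A B. positive_op A \<longrightarrow> positive_op B \<longrightarrow> \<sigma> id_blinfun A = \<sigma> id_blinfun B \<longrightarrow> A = B)"
    (is "_ \<longleftrightarrow> ?inj")
proof
  have "strictly_positive_op (id_blinfun :: 'a op)"
    unfolding strictly_positive_op_def is_inverse_op_def
    by (intro conjI bexI[of _ id_blinfun]) simp_all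
  then show "left_cancellable_connection \<sigma> \<Longrightarrow> ?inj"
    unfolding left_cancellable_connection_def by blast
next
  assume inj: ?inj
  show "left_cancellable_connection \<sigma>"
    unfolding left_cancellable_connection_def
  proof (intro allI impI)
    fix A B C :: "'a op"
    assume A: "strictly_positive_op A" and B: "positive_op B" and C: "positive_op C"
      and eq: "\<sigma> A B = \<sigma> A C"
    obtain S R where SR: "positive_op S" "positive_op R" "is_inverse_op S R" and S: "S o\<^sub>L S = A"
      using strictly_positive_op_sqrt[OF A] .
    have RS: "is_inverse_op R S" using SR(3) by (simp add: is_inverse_op_def)
    have A': "positive_op A" using A by (simp add: strictly_positive_op_def)
    have "R o\<^sub>L A o\<^sub>L R = id_blinfun"
      using SR(3) unfolding is_inverse_op_def S[symmetric]
      by (metis blinfun_compose_assoc blinfun_compose_id)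
    then have "\<sigma> id_blinfun (R o\<^sub>L B o\<^sub>L R) = \<sigma> id_blinfun (R o\<^sub>L C o\<^sub>L R)"
      using connection_congruence[OF \<sigma> A' B SR(2,1) RS] connection_congruence[OF \<sigma> A' C SR(2,1) RS] eq
      by simp
    then have "R o\<^sub>L B o\<^sub>L R = R o\<^sub>L C o\<^sub>L R"
      using inj positive_op_conjugate SR(2) B C by blast
    then have "S o\<^sub>L (R o\<^sub>L B o\<^sub>L R) o\<^sub>L S = S o\<^sub>L (R o\<^sub>L C o\<^sub>L R) o\<^sub>L S" by simp
    then show "B = C"
      using SR(3) unfolding is_inverse_op_def by (metis blinfun_compose_assoc blinfun_compose_id)
  qed
qed

text \<open>If almost every point is \<open>0\<close>, a measurable set has full mass or none
  according to whether it contains \<open>0\<close>; the scalar is therefore the total mass.\<close>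

lemma multiple_of_dirac_0_iff:
  assumes sets: "sets \<mu> = sets unit_borel" and "finite_measure \<mu>"
  shows "multiple_of_dirac_0 \<mu> \<longleftrightarrow> (AE t in \<mu>. t = 0)"
proof
  interpret finite_measure \<mu> by fact
  have meas: "{0} \<in> sets unit_borel" by (simp add: sets_restrict_space_iff)
  assume AE: "AE t in \<mu>. t = 0"
  have "\<mu> = scale_measure (ennreal (measure \<mu> (space \<mu>))) (return unit_borel 0)"
  proof (rule measure_eqI)
    fix X assume X: "X \<in> sets \<mu>"
    show "emeasure \<mu> X = emeasure (scale_measure (ennreal (measure \<mu> (space \<mu>))) (return unit_borel 0)) X"
    proof (cases "0 \<in> X")
      case True
      have "emeasure \<mu> X = emeasure \<mu> (space \<mu>)"
        by (rule emeasure_eq_AE) (use AE True X in \<open>auto dest: sets.sets_into_space elim!: eventually_mono\<close>)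
      then show ?thesis using True X sets by (simp add: emeasure_eq_measure)
    next
      case False
      have "emeasure \<mu> X = emeasure \<mu> {}"
        by (rule emeasure_eq_AE) (use AE False X in \<open>auto elim!: eventually_mono\<close>)
      then show ?thesis using False X sets by simp
    qed
  qed (simp add: sets)
  then show "multiple_of_dirac_0 \<mu>"
    unfolding multiple_of_dirac_0_def by (intro exI[of _ "measure \<mu> (space \<mu>)"]) simp
next
  assume "multiple_of_dirac_0 \<mu>"
  then obtain k where k: "\<mu> = scale_measure (ennreal k) (return unit_borel 0)"
    unfolding multiple_of_dirac_0_def by blast
  \<comment> \<open>This set is the complement of the point \<open>0\<close> in the underlying
    space.\<close>
  have N: "{0<..1} \<in> sets unit_borel" by (auto simp: sets_restrict_space_iff)
  then have "emeasure \<mu> {0<..1} = 0" by (simp add: k)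
  moreover have "{0<..1} \<in> sets \<mu>" using N sets by simp
  ultimately have "{0<..1} \<in> null_sets \<mu>" by (simp add: null_sets_def)
  moreover have "space \<mu> = {0..1}" using sets_eq_imp_space_eq[OF sets] by (simp add: space_restrict_space)
  ultimately show "AE t in \<mu>. t = 0"
    by (intro AE_I'[of "{0<..1}"]) auto
qed

theorem theorem2p3:
  fixes \<sigma> :: "'a::complex_hilbert_space op \<Rightarrow> 'a op \<Rightarrow> 'a op"
    and f :: "real \<Rightarrow> real"
    and \<mu> :: "real measure"
  assumes "\<exists>x::'a. x \<noteq> 0"
    and "connection \<sigma>"
    and "representing_function \<sigma> f"
    and "associated_measure \<sigma> \<mu>"
  shows
    "(left_cancellable_connection \<sigma> \<longleftrightarrow>
        (\<forall>A B. positive_op A \<longrightarrow> positive_op B \<longrightarrow> \<sigma> id_blinfun A = \<sigma> id_blinfun B \<longrightarrow> A = B)) \<and>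
     (left_cancellable_connection \<sigma> \<longleftrightarrow> \<not> multiple_of_left_trivial \<sigma>) \<and>
     (left_cancellable_connection \<sigma> \<longleftrightarrow> inj_on f {0..}) \<and>
     (left_cancellable_connection \<sigma> \<longleftrightarrow> left_cancellable_function TYPE('x) f) \<and>
     (left_cancellable_connection \<sigma> \<longleftrightarrow> \<not> f constant_on {0..}) \<and>
     (left_cancellable_connection \<sigma> \<longleftrightarrow> \<not> multiple_of_dirac_0 \<mu>)"
proof -
  note nz = assms(1) and \<sigma> = assms(2) and f = assms(3) and \<mu> = assms(4)
  have sets: "sets \<mu> = sets unit_borel" and "finite_measure \<mu>"
    using \<mu> by (simp_all add: associated_measure_def)
  interpret finite_measure \<mu> by fact
  have space: "space \<mu> = {0..1}" by (rule associated_measure_space[OF \<mu>])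
  have f_cont: "continuous_on {0..} f"
    using f by (simp add: representing_function_def operator_monotone_def)
  note integral_f = representing_function_integral[OF nz f \<mu>]
  have id_nz: "(id_blinfun :: 'a op) \<noteq> 0"
    using nz by (metis blinfun_apply_id_blinfun zero_blinfun.rep_eq)
  let ?inj = "\<forall>A B. positive_op A \<longrightarrow> positive_op B \<longrightarrow> \<sigma> id_blinfun A = \<sigma> id_blinfun B \<longrightarrow> A = B"
  let ?AE = "AE t in \<mu>. t = 0"

  have 1: ?inj if "inj_on f {0..}"
    using cfc_inject[OF _ _ f_cont that] by (simp add: connection_id_eq_cfc[OF nz f \<mu>]) blast
  have 2: "\<not> multiple_of_left_trivial \<sigma>" if inj: ?inj
  proof
    assume "multiple_of_left_trivial \<sigma>"
    \<comment> \<open>A multiple of the left-trivial mean cannot tell the second arguments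
      \<open>0\<close> and \<open>I\<close> apart, which differ on a nonzero space.\<close>
    then have "\<sigma> id_blinfun 0 = \<sigma> id_blinfun id_blinfun"
      unfolding multiple_of_left_trivial_def by force
    then have "0 = (id_blinfun :: 'a op)" using inj positive_op_zero positive_op_id by blast
    with id_nz show False by simp
  qed
  \<comment> \<open>Only \<open>t = 0\<close> contributes to the integral, where the mean is
    \<open>A\<close>; integrating this constant produces the total mass as the factor.\<close>
  have 3: "multiple_of_left_trivial \<sigma>" if AE: ?AE
    unfolding multiple_of_left_trivial_def
  proof (intro exI[of _ "measure \<mu> (space \<mu>)"] conjI allI impI)
    fix A B :: "'a op" assume A: "positive_op A" and B: "positive_op B"
    show "\<sigma> A B = measure \<mu> (space \<mu>) *\<^sub>R A"
    proof (rule blinfun_eqI)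
      fix v
      have "inner u (blinfun_apply (\<sigma> A B) v) = inner u (blinfun_apply (measure \<mu> (space \<mu>) *\<^sub>R A) v)" for u
      proof -
        note int = associated_measure_inner[OF \<mu> A B, of u v]
        have "inner u (blinfun_apply (\<sigma> A B) v)
            = (\<integral>t. inner u (blinfun_apply (harmonic_mean t A B) v) \<partial>\<mu>)"
          by (rule has_bochner_integral_integral_eq[OF int, symmetric])
        also have "\<dots> = (\<integral>t. inner u (blinfun_apply A v) \<partial>\<mu>)"
          by (rule integral_cong_AE)
            (use AE int in \<open>auto simp: harmonic_mean_0[OF A] has_bochner_integral_iff elim!: eventually_mono\<close>)
        also have "\<dots> = inner u (blinfun_apply (measure \<mu> (space \<mu>) *\<^sub>R A) v)"
          by (simp add: blinfun.scaleR_left)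
        finally show ?thesis .
      qed
      then show "blinfun_apply (\<sigma> A B) v = blinfun_apply (measure \<mu> (space \<mu>) *\<^sub>R A) v"
        using vector_eq_ldot by blast
    qed
  qed simp
  have 4: "f constant_on {0..}" if AE: ?AE
    unfolding constant_on_def
  proof (intro exI ballI)
    fix x :: real assume "x \<in> {0..}"
    then have int: "has_bochner_integral \<mu> (\<lambda>t. harmonic_kernel t x) (f x)"
      by (intro integral_f) simp
    have "f x = (\<integral>t. harmonic_kernel t x \<partial>\<mu>)"
      by (rule has_bochner_integral_integral_eq[OF int, symmetric])
    also have "\<dots> = (\<integral>t. 1 \<partial>\<mu>)"
      by (rule integral_cong_AE)
        (use AE int in \<open>auto simp: harmonic_kernel_def has_bochner_integral_iff elim!: eventually_mono\<close>)
    finally show "f x = (\<integral>t. 1 \<partial>\<mu>)" .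
  qed
  \<comment> \<open>One coincidence \<open>f x = f y\<close> suffices: the kernel difference is
    nonnegative with integral \<open>0\<close>, so it vanishes almost everywhere, yet it is positive
    for every \<open>t\<close> other than \<open>0\<close>.\<close>
  have 5: ?AE if xy: "0 \<le> x" "x < y" and eq: "f x = f y" for x y
  proof -
    let ?d = "\<lambda>t. harmonic_kernel t y - harmonic_kernel t x"
    have int: "has_bochner_integral \<mu> ?d (f y - f x)"
      using xy by (intro has_bochner_integral_diff integral_f) auto
    have less: "0 < ?d t" if "t \<in> space \<mu>" "t \<noteq> 0" for t
      using harmonic_kernel_strict_mono[of t x y] that xy space by simp
    have zero: "?d 0 = 0" by (simp add: harmonic_kernel_def)
    have "0 \<le> ?d t" if "t \<in> space \<mu>" for t
      using less[OF that] zero by (cases "t = 0") (auto simp del: diff_ge_0_iff_ge)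
    then have "AE t in \<mu>. 0 \<le> ?d t" by (rule AE_I2)
    moreover have "integral\<^sup>L \<mu> ?d = 0"
      using has_bochner_integral_integral_eq[OF int] eq by simp
    ultimately have "AE t in \<mu>. ?d t = 0"
      using integral_nonneg_eq_0_iff_AE[of \<mu> ?d] int unfolding has_bochner_integral_iff by blast
    then show ?AE
      using AE_space by eventually_elim (use less in force)
  qed
  have 6: "inj_on f {0..}" if "\<not> ?AE"
    by (rule linorder_inj_onI) (use 5 that in auto)
  have 7: "\<not> f constant_on {0..}" if "inj_on f {0..}"
    using inj_onD[OF that, of 0 1] unfolding constant_on_def by fastforce
  have 8: "left_cancellable_function TYPE('x) f \<longleftrightarrow> inj_on f {0..}"
  proof
    assume L: "left_cancellable_function TYPE('x) f"
    show "inj_on f {0..}"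
    proof (rule inj_onI)
      fix x y :: real assume "x \<in> {0..}" "y \<in> {0..}" "f x = f y"
      \<comment> \<open>Types are nonempty, so two constant functions on \<open>UNIV\<close> compare
        a single pair of values.\<close>
      then show "x = y"
        using L[unfolded left_cancellable_function_def, rule_format,
            of "\<lambda>_. x" UNIV "\<lambda>_. y"] by auto
    qed
  next
    assume "inj_on f {0..}"
    then show "left_cancellable_function TYPE('x) f"
      unfolding left_cancellable_function_def inj_on_def by blast
  qed
  \<comment> \<open>Two cycles share the step from failure of \<open>?AE\<close> to injectivity of
    \<open>f\<close>: one returns through cancellation at \<open>I\<close> and the left-trivial mean
    (1, 2, 3), the other through nonconstancy (7, 4).\<close>
  show ?thesis
    unfolding left_cancellable_connection_iff[OF \<sigma>] 8 multiple_of_dirac_0_iff[OF sets \<open>finite_measure \<mu>\<close>]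
    using 1 2 3 4 6 7 by blast
qed

end
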